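(* Let $d$ be a prime and let $m\geq 2$ and $n\geq 1$ be integers. Then the number of irreducible factors of the Misiurewicz polynomial $G_{d,m,n}(c)\in\mathbb{Z}[c]$ over $\mathbb{Q}$ is bounded from above by the number of irreducible factors of the reduction $\overline{G_{d,0,n}}(c)\in\mathbb{F}_d[c]$ of $G_{d,0,n}(c)$ modulo $d$. In particular, if $\overline{G_{d,0,n}}(c)$ is irreducible over $\mathbb{F}_d$, then $G_{d,m,n}(c)$ is irreducible over $\mathbb{Q}$.
   Context: For an integer $d\geq 2$ let $f_{c,d}(x)=x^d+c$, and write $f_{c,d}^k$ for the $k$-th iterate ($f_{c,d}^0(x)=x$); $f_{c,d}^k(0)$ is a polynomial in $c$ with integer coefficients. Let $\mu$ denote the Möbius function. Define $G_{d,0,n}(c)=\prod_{k\mid n}\big(f_{c,d}^k(0)\big)^{\mu(n/k)}$. For $m\geq 1$ set $$F_{d,m,n}(c)=\prod_{k\mid n}\left(\frac{f_{c,d}^{m+k}(0)-f_{c,d}^m(0)}{f_{c,d}^{m-1+k}(0)-f_{c,d}^{m-1}(0)}\right)^{\mu(n/k)},$$ and for $m\geq 2$ define $G_{d,m,n}(c)=F_{d,m,n}(c)$ if $n\nmid m-1$, and $G_{d,m,n}(c)=F_{d,m,n}(c)/F_{d,1,n}(c)$ if $n\mid m-1$. These $G_{d,m,n}(c)$ (for $m=0$ or $m\ge 2$) are polynomials with integer coefficients; $\overline{G}$ denotes reduction of coefficients modulo $d$. *)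

theory Defs
  imports
    "HOL-Computational_Algebra.Computational_Algebra"
    "HOL-Computational_Algebra.Field_as_Ring"
    "Berlekamp_Zassenhaus.Finite_Field"
begin

definition moebius :: "nat \<Rightarrow> int" where
  "moebius n = (if squarefree n then (-1) ^ card (prime_factors n) else 0)"

text \<open>The parameter \<open>c\<close> is the variable \<open>[:0, 1:]\<close> of \<open>int poly\<close>, so
  \<open>crit_orbit d k\<close> is the \<open>k\<close>-th iterate of \<open>x^d + c\<close> at \<open>0\<close> as an element of
  \<open>\<int>[c]\<close>.\<close>

definition crit_orbit :: "nat \<Rightarrow> nat \<Rightarrow> int poly" where
  "crit_orbit d k = ((\<lambda>x. x ^ d + [:0, 1:]) ^^ k) 0"

text \<open>The products with exponents \<open>\<mu>(n/k)\<close> are formed in the fraction field of \<open>\<int>[c]\<close>.\<close>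

definition misiurewicz_F :: "nat \<Rightarrow> nat \<Rightarrow> nat \<Rightarrow> int poly fract" where
  "misiurewicz_F d m n =
     (\<Prod>k | k dvd n.
        (to_fract (crit_orbit d (m + k) - crit_orbit d m) /
         to_fract (crit_orbit d (m - 1 + k) - crit_orbit d (m - 1)))
        powi moebius (n div k))"

text \<open>Only \<open>m = 0\<close> and \<open>m \<ge> 2\<close> are meaningful here; the value at \<open>m = 1\<close> is never used.\<close>

definition misiurewicz_fract :: "nat \<Rightarrow> nat \<Rightarrow> nat \<Rightarrow> int poly fract" where
  "misiurewicz_fract d m n =
     (if m = 0 then \<Prod>k | k dvd n. to_fract (crit_orbit d k) powi moebius (n div k)
      else if n dvd m - 1 then misiurewicz_F d m n / misiurewicz_F d 1 n
      else misiurewicz_F d m n)"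

text \<open>\<open>misiurewicz_fract d m n\<close> lies in \<open>\<int>[c]\<close>; the following is that element. Uniqueness
  is the injectivity of \<open>to_fract\<close>.\<close>

definition misiurewicz_poly :: "nat \<Rightarrow> nat \<Rightarrow> nat \<Rightarrow> int poly" where
  "misiurewicz_poly d m n = (THE p. to_fract p = misiurewicz_fract d m n)"

text \<open>Irreducible factors over a field, counted with multiplicity and up to units, each class
  being represented by its monic member.\<close>

definition num_irreducible_factors :: "'a :: field_gcd poly \<Rightarrow> nat" where
  "num_irreducible_factors p =
     (\<Sum>q | irreducible q \<and> lead_coeff q = 1 \<and> q dvd p. multiplicity q p)"

lemma num_irreducible_factors_eq_size_prime_factorization:
  fixes p :: "'a :: field_gcd poly"
  assumes "p \<noteq> 0"
  shows "num_irreducible_factors p = size (prime_factorization p)"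
proof -
  have norm: "normalize q = q \<longleftrightarrow> lead_coeff q = 1" if "q \<noteq> 0" for q :: "'a poly"
  proof
    assume "normalize q = q"
    hence "unit_factor q = 1" using that by (metis unit_factor_normalize)
    thus "lead_coeff q = 1"
      using that by (simp add: unit_factor_poly_def one_pCons unit_factor_field)
  qed (simp add: normalize_monic)
  have nz: "q \<noteq> 0" if "irreducible q" for q :: "'a poly"
    using that by auto
  have eq: "{q. irreducible q \<and> lead_coeff q = 1 \<and> q dvd p} = prime_factors p"
    using assms norm nz
    by (auto simp: in_prime_factors_iff prime_def prime_elem_iff_irreducible)
  show ?thesis
    unfolding num_irreducible_factors_def eq size_multiset_overloaded_eq
    by (intro sum.cong) (auto simp: count_prime_factorization_prime in_prime_factors_iff)
qed

end

theory Submission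
  imports Defs
begin

text \<open>
  Let \<open>a\<^sub>k\<close> be the critical orbit. For a prime \<open>\<pi>\<close> of \<open>\<int>[c]\<close> the multiplicity of \<open>\<pi>\<close> in
  \<open>a\<^sub>m\<^sub>+\<^sub>k - a\<^sub>m\<close> is a constant (depending on \<open>m\<close>) if \<open>k\<close> is a multiple of the exact period \<open>r\<close> of
  the orbit modulo \<open>\<pi>\<close>, and zero otherwise: the derivative of \<open>x\<^sup>d + c\<close> vanishes modulo \<open>d\<close>, so
  \<open>a\<^sub>m\<^sub>+\<^sub>j\<^sub>r - a\<^sub>m\<close> is \<open>a\<^sub>m\<^sub>+\<^sub>r - a\<^sub>m\<close> times an element of \<open>1 + (d, \<pi>)\<close>, which \<open>\<pi>\<close> cannot divide,
  being monic up to sign. Hence the Moebius products are polynomials.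

  Modulo \<open>d\<close> the difference \<open>a\<^sub>m\<^sub>+\<^sub>k - a\<^sub>m\<close> becomes a power of \<open>a\<^sub>k\<close>, so the reduction of
  \<open>G\<^sub>d\<^sub>,\<^sub>m\<^sub>,\<^sub>n\<close> is a power of that of \<open>G\<^sub>d\<^sub>,\<^sub>0\<^sub>,\<^sub>n\<close>, which is squarefree because \<open>a\<^sub>n\<close> has derivative \<open>1\<close>
  modulo \<open>d\<close>. Let \<open>g\<close> be irreducible and divide this reduction. The factor of \<open>G\<^sub>d\<^sub>,\<^sub>m\<^sub>,\<^sub>n\<close> with
  \<open>k = n\<close> has the form \<open>d Y + a\<^sub>n S\<close> with \<open>Y\<close> prime to \<open>g\<close>; this is an Eisenstein-type condition at
  the maximal ideal \<open>M = (d, g)\<close>. If \<open>G\<^sub>d\<^sub>,\<^sub>m\<^sub>,\<^sub>n = p q\<close> with \<open>g\<close> dividing both reductions, then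
  \<open>p q\<close> and \<open>a\<^sub>n S\<close> lie in \<open>M\<^sup>2\<close>, hence so does \<open>d Y\<close> up to a factor outside \<open>M\<close>, which is
  impossible. So the irreducible factors of \<open>G\<^sub>d\<^sub>,\<^sub>m\<^sub>,\<^sub>n\<close> have pairwise coprime reductions, and
  each reduction takes up at least one prime factor of the reduction of \<open>G\<^sub>d\<^sub>,\<^sub>0\<^sub>,\<^sub>n\<close>.
\<close>

section \<open>The Moebius function and its divisor sums\<close>

lemma moebius_cases: "moebius n = 1 \<or> moebius n = -1 \<or> moebius n = 0"
  by (auto simp: moebius_def minus_one_power_iff)

lemma moebius_1 [simp]: "moebius 1 = 1" "moebius (Suc 0) = 1"
  by (simp_all add: moebius_def)

lemma moebius_prime_mult:
  assumes "prime p" "\<not> p dvd j"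
  shows "moebius (p * j) = - moebius j"
proof -
  have j: "j \<noteq> 0" using assms(2) by (metis dvd_0_right)
  have cop: "coprime p j" using assms by (simp add: prime_imp_coprime)
  have "squarefree (p * j) \<longleftrightarrow> squarefree j"
    using assms cop squarefree_mono[of j "p * j"] by (auto intro: squarefree_mult_coprime squarefree_prime)
  moreover have "prime_factors (p * j) = insert p (prime_factors j)"
    using assms j by (subst prime_factors_product) (auto simp: prime_prime_factors)
  moreover have "p \<notin> prime_factors j" using assms(2) by auto
  ultimately show ?thesis by (simp add: moebius_def)
qed

lemma moebius_eq_0_if_square_dvd:
  assumes "prime p" "p * p dvd k"
  shows "moebius k = 0"
proof -
  have "\<not> squarefree k" using assms
    by (metis not_prime_unit power2_eq_square squarefree_def)
  thus ?thesis by (simp add: moebius_def)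
qed

text \<open>Fix a prime \<open>p\<close> dividing \<open>n\<close>. The divisors \<open>j\<close>
  prime to \<open>p\<close> cancel against the divisors \<open>p * j\<close>, and multiples of
  \<open>p * p\<close> contribute 0.\<close>

lemma sum_moebius_divisors:
  fixes n :: nat
  assumes "n > 0"
  shows "(\<Sum>k | k dvd n. moebius k) = (if n = 1 then 1 else 0)"
proof (cases "n = 1")
  case True
  have "{k. k dvd (1::nat)} = {1}" by auto
  thus ?thesis using True by simp
next
  case False
  then obtain p where p: "prime p" "p dvd n" using prime_factor_nat by blast
  let ?D = "{k. k dvd n}" let ?A = "{k. k dvd n \<and> \<not> p dvd k}" let ?B = "{k. k dvd n \<and> p dvd k}"
  have fin: "finite ?D" using assms by simp
  have p0: "p > 0" using p(1) prime_gt_0_nat by blast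
  have "sum moebius ?B = (\<Sum>k\<in>(\<lambda>j. p * j) ` ?A. moebius k)"
  proof (rule sum.mono_neutral_right)
    show "finite ?B" using fin by simp
    show "(\<lambda>j. p * j) ` ?A \<subseteq> ?B"
      using p by (auto simp: prime_imp_coprime intro!: divides_mult)
    show "\<forall>i\<in>?B - (\<lambda>j. p * j) ` ?A. moebius i = 0"
    proof
      fix i assume i: "i \<in> ?B - (\<lambda>j. p * j) ` ?A"
      then obtain j where j: "i = p * j" by auto
      have "p dvd j" using i j by (auto dest: dvd_mult_right)
      hence "p * p dvd i" using j by simp
      thus "moebius i = 0" using moebius_eq_0_if_square_dvd p(1) by blast
    qed
  qed
  also have "\<dots> = (\<Sum>k\<in>?A. moebius (p * k))"
    using p0 by (subst sum.reindex) (auto simp: inj_on_def)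
  also have "\<dots> = - sum moebius ?A"
    using moebius_prime_mult[OF p(1)] by (simp add: sum_negf)
  finally have "sum moebius ?A + sum moebius ?B = 0" by simp
  moreover have "sum moebius ?D = sum moebius ?A + sum moebius ?B"
    using fin by (subst sum.union_disjoint[symmetric]) (auto intro!: sum.cong)
  ultimately show ?thesis using False by simp
qed

text \<open>With \<open>n = r * s\<close>, the substitution \<open>k = r * (s div j)\<close> leads
  to the sum over all divisors of \<open>s\<close>. If \<open>r\<close> does not divide
  \<open>n\<close>, in particular if \<open>r = 0\<close>, the index set is empty.\<close>

lemma sum_moebius_multiples:
  fixes n r :: nat
  assumes "n > 0"
  shows "(\<Sum>k | k dvd n \<and> r dvd k. moebius (n div k)) = (if n = r then 1 else 0)"
proof (cases "r dvd n")
  case False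
  hence "{k. k dvd n \<and> r dvd k} = {}" by (auto dest: dvd_trans)
  moreover have "n \<noteq> r" using False by auto
  ultimately show ?thesis by (simp only: sum.empty if_False)
next
  case True
  then obtain s where s: "n = r * s" by auto
  hence pos: "r > 0" "s > 0" using assms by auto
  have "(\<Sum>k | k dvd n \<and> r dvd k. moebius (n div k)) = (\<Sum>j | j dvd s. moebius j)"
  proof (rule sum.reindex_bij_witness[of _ "\<lambda>j. r * (s div j)" "\<lambda>k. n div k"])
    fix k assume "k \<in> {k. k dvd n \<and> r dvd k}"
    then obtain t where t: "k = r * t" "t dvd s" using s pos by auto
    then obtain u where u: "s = t * u" by auto
    have nz: "t > 0" "u > 0" using u pos by auto
    have e: "n div k = u" using s u t nz pos by simp
    show "r * (s div (n div k)) = k" unfolding e using u nz t by simp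
    show "n div k \<in> {j. j dvd s}" unfolding e using u by simp
  next
    fix j assume "j \<in> {j. j dvd s}"
    then obtain t where t: "s = j * t" by auto
    have nz: "j > 0" "t > 0" using t pos by auto
    show "n div (r * (s div j)) = j" using s t nz pos by simp
    show "r * (s div j) \<in> {k. k dvd n \<and> r dvd k}" using s t nz by auto
  qed simp
  also have "\<dots> = (if n = r then 1 else 0)"
    using sum_moebius_divisors[OF pos(2)] s pos by auto
  finally show ?thesis .
qed

section \<open>Moebius products in a ring, split into numerator and denominator\<close>

definition moebius_num :: "nat \<Rightarrow> (nat \<Rightarrow> 'a :: comm_monoid_mult) \<Rightarrow> 'a" where
  "moebius_num n f = (\<Prod>k | k dvd n \<and> moebius (n div k) = 1. f k)"

definition moebius_den :: "nat \<Rightarrow> (nat \<Rightarrow> 'a :: comm_monoid_mult) \<Rightarrow> 'a" where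
  "moebius_den n f = (\<Prod>k | k dvd n \<and> moebius (n div k) = -1. f k)"

lemma prod_powi_moebius:
  fixes f :: "nat \<Rightarrow> 'a :: field"
  assumes "n > 0"
  shows "(\<Prod>k | k dvd n. f k powi moebius (n div k)) = moebius_num n f / moebius_den n f"
proof -
  let ?D = "\<lambda>i. {k. k dvd n \<and> moebius (n div k) = i}"
  have D: "{k. k dvd n} = ?D 1 \<union> (?D (-1) \<union> ?D 0)" using moebius_cases by auto
  have fin: "finite (?D i)" for i using assms by simp
  have "(\<Prod>k | k dvd n. f k powi moebius (n div k)) =
      (\<Prod>k\<in>?D 1. f k powi moebius (n div k)) *
      ((\<Prod>k\<in>?D (-1). f k powi moebius (n div k)) * (\<Prod>k\<in>?D 0. f k powi moebius (n div k)))"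
    unfolding D using fin
    by (subst prod.union_disjoint, simp, simp, force, subst prod.union_disjoint) auto
  also have "(\<Prod>k\<in>?D 1. f k powi moebius (n div k)) = moebius_num n f"
    unfolding moebius_num_def by (rule prod.cong) auto
  also have "(\<Prod>k\<in>?D (-1). f k powi moebius (n div k)) = (\<Prod>k\<in>?D (-1). inverse (f k))"
    by (rule prod.cong) (auto simp: power_int_minus)
  also have "\<dots> = inverse (moebius_den n f)"
    unfolding moebius_den_def by (rule prod_inversef[unfolded o_def])
  also have "(\<Prod>k\<in>?D 0. f k powi moebius (n div k)) = 1"
    by (rule prod.neutral) auto
  finally show ?thesis by (simp add: field_simps)
qed

text \<open>Both multiplicities are \<open>v\<close> times a number of multiples of \<open>r\<close>
  among the divisors, and the difference of these two numbers is the sum in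
  \<open>sum_moebius_multiples\<close>. The additive form avoids subtraction of natural
  numbers.\<close>

lemma multiplicity_moebius_num_den:
  fixes f :: "nat \<Rightarrow> 'a :: factorial_semiring"
  assumes n: "n > 0" and pi: "prime_elem \<pi>" and nz: "\<And>k. k dvd n \<Longrightarrow> f k \<noteq> 0"
    and mult: "\<And>k. k dvd n \<Longrightarrow> multiplicity \<pi> (f k) = (if r dvd k then v else 0)"
  shows "multiplicity \<pi> (moebius_num n f) =
         multiplicity \<pi> (moebius_den n f) + (if n = r then v else 0)"
proof -
  let ?D = "\<lambda>i. {k. k dvd n \<and> moebius (n div k) = i}"
  let ?E = "\<lambda>i. {k. (k dvd n \<and> moebius (n div k) = i) \<and> r dvd k}"
  have fin: "finite (?D i)" for i using n by simp
  have fin': "finite (?E i)" for i by (rule finite_subset[OF _ fin[of i]]) auto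
  have *: "multiplicity \<pi> (prod f (?D i)) = (\<Sum>k\<in>?E i. v)" for i
  proof -
    have "multiplicity \<pi> (prod f (?D i)) = (\<Sum>k\<in>?D i. multiplicity \<pi> (f k))"
      using nz fin by (intro prime_elem_multiplicity_prod_distrib pi) auto
    also have "\<dots> = (\<Sum>k\<in>?D i. if r dvd k then v else 0)"
      by (rule sum.cong) (auto simp: mult)
    also have "\<dots> = (\<Sum>k\<in>{k \<in> ?D i. r dvd k}. v)"
      using fin[of i] by (rule sum.inter_filter[symmetric])
    finally show ?thesis by simp
  qed
  have "int (if n = r then v else 0) = (if n = r then 1 else 0) * int v" by simp
  also have "\<dots> = (\<Sum>k | k dvd n \<and> r dvd k. moebius (n div k)) * int v"
    by (simp add: sum_moebius_multiples[OF n])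
  also have "(\<Sum>k | k dvd n \<and> r dvd k. moebius (n div k)) =
     (\<Sum>k\<in>?E 1 \<union> (?E (-1) \<union> ?E 0). moebius (n div k))"
    using moebius_cases by (intro sum.cong) auto
  also have "\<dots> = (\<Sum>k\<in>?E 1. moebius (n div k)) + ((\<Sum>k\<in>?E (-1). moebius (n div k)) +
      (\<Sum>k\<in>?E 0. moebius (n div k)))"
    using fin' by (subst sum.union_disjoint, simp, simp, force, subst sum.union_disjoint) auto
  also have "\<dots> = int (card (?E 1)) - int (card (?E (-1)))"
    by simp
  finally have "int (if n = r then v else 0) + int (card (?E (-1)) * v) = int (card (?E 1) * v)"
    by (simp add: algebra_simps)
  hence "card (?E 1) * v = card (?E (-1)) * v + (if n = r then v else 0)"
    by linarith
  thus ?thesis unfolding moebius_num_def moebius_den_def * by simp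
qed

section \<open>Reduction of integer polynomials modulo a prime\<close>

abbreviation (input) reduct :: "int poly \<Rightarrow> 'p :: prime_card mod_ring poly" where
  "reduct \<equiv> map_poly of_int"

lemma reduct_of_nat_card [simp]: "reduct (of_nat CARD('p)) = (0 :: 'p :: prime_card mod_ring poly)"
  by (simp add: of_nat_poly)

lemma of_int_mod_ring_eq_0_imp_dvd:
  assumes "of_int x = (0 :: 'p :: prime_card mod_ring)"
  shows "int CARD('p) dvd x"
proof -
  have "of_nat (nat \<bar>x\<bar>) = (0 :: 'p mod_ring)"
    using assms by (cases "x \<ge> 0") auto
  from of_nat_0_mod_ring_dvd[OF this] show ?thesis
    by (metis dvd_abs_iff int_dvd_int_iff int_nat_eq abs_ge_zero)
qed

lemma reduct_eq_0_imp_dvd: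
  assumes "reduct p = (0 :: 'p :: prime_card mod_ring poly)"
  shows "of_nat CARD('p) dvd p"
proof -
  have "of_int (poly.coeff p i) = (0 :: 'p mod_ring)" for i
    using arg_cong[OF assms, of "\<lambda>q. poly.coeff q i"] by simp
  hence "[:int CARD('p):] dvd p"
    by (intro const_poly_dvd_iff[THEN iffD2] allI of_int_mod_ring_eq_0_imp_dvd)
  thus ?thesis by (simp add: of_nat_poly)
qed

lemma degree_reduct_dvd_monic:
  assumes "lead_coeff f = 1" "p dvd f"
  shows "degree (reduct p :: 'p :: prime_card mod_ring poly) = degree p"
proof -
  obtain h where "f = p * h" using assms(2) by auto
  hence "lead_coeff p * lead_coeff h = 1" using assms(1) by (simp add: lead_coeff_mult)
  hence "lead_coeff p = 1 \<or> lead_coeff p = -1" by (metis zmult_eq_1_iff)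
  hence "of_int (lead_coeff p) \<noteq> (0 :: 'p mod_ring)" by auto
  hence "degree p \<le> degree (reduct p :: 'p mod_ring poly)" by (intro le_degree) simp
  thus ?thesis using degree_map_poly_le[of "of_int :: int \<Rightarrow> 'p mod_ring" p] by simp
qed

lemma dvd_monic_degree_0_imp_unit:
  fixes f p :: "int poly"
  assumes "lead_coeff f = 1" "p dvd f" "degree p = 0"
  shows "p dvd 1"
proof -
  obtain h where "f = p * h" using assms(2) by auto
  hence "lead_coeff p * lead_coeff h = 1" using assms(1) by (simp add: lead_coeff_mult)
  hence "lead_coeff p dvd 1" by (metis dvd_triv_left)
  moreover have "p = [:lead_coeff p:]" using assms(3) by (metis degree_eq_zeroE lead_coeff_pCons(2))
  ultimately show ?thesis by (metis is_unit_const_poly_iff)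
qed

text \<open>A divisor of a monic polynomial has leading coefficient 1 or -1, so reduction keeps its
  degree. Dividing \<open>1 + d q\<close> would make the reduction a unit, hence of degree 0, and
  then \<open>\<pi>\<close> itself would be a unit.\<close>

lemma not_dvd_1_mod_card:
  fixes f \<pi> :: "int poly"
  assumes "lead_coeff f = 1" "\<pi> dvd f" "\<not> \<pi> dvd 1"
  shows "\<not> \<pi> dvd 1 + of_nat CARD('p :: prime_card) * q"
proof
  assume "\<pi> dvd 1 + of_nat CARD('p) * q"
  then obtain h where "1 + of_nat CARD('p) * q = \<pi> * h" by auto
  hence "reduct (1 + of_nat CARD('p) * q) = (reduct (\<pi> * h) :: 'p mod_ring poly)" by simp
  hence "reduct \<pi> * reduct h = (1 :: 'p mod_ring poly)"
    by (simp add: of_int_poly_hom.hom_add of_int_poly_hom.hom_mult del: of_int_poly_hom.hom_of_nat)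
  hence "reduct \<pi> dvd (1 :: 'p mod_ring poly)" by (metis dvd_triv_left)
  hence "degree (reduct \<pi> :: 'p mod_ring poly) = 0" by (simp add: poly_dvd_1)
  hence "degree \<pi> = 0" using degree_reduct_dvd_monic[OF assms(1,2), where ?'p = 'p] by simp
  thus False using dvd_monic_degree_0_imp_unit assms by blast
qed

section \<open>Differences along the critical orbit and their multiplicities\<close>

definition orbit_diff :: "nat \<Rightarrow> nat \<Rightarrow> nat \<Rightarrow> int poly" where
  "orbit_diff d m k = crit_orbit d (m + k) - crit_orbit d m"

lemma crit_orbit_0 [simp]: "crit_orbit d 0 = 0"
  by (simp add: crit_orbit_def)

lemma crit_orbit_Suc: "crit_orbit d (Suc k) = crit_orbit d k ^ d + [:0, 1:]"
  by (simp add: crit_orbit_def)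

lemma orbit_diff_0_left [simp]: "orbit_diff d 0 k = crit_orbit d k"
  by (simp add: orbit_diff_def)

lemma orbit_diff_0_right [simp]: "orbit_diff d m 0 = 0"
  by (simp add: orbit_diff_def)

lemma orbit_diff_add: "orbit_diff d m (j + k) = orbit_diff d (m + j) k + orbit_diff d m j"
  by (simp add: orbit_diff_def add.assoc)

definition power_quot :: "nat \<Rightarrow> 'a :: comm_ring_1 \<Rightarrow> 'a \<Rightarrow> 'a" where
  "power_quot d x y = (\<Sum>i<d. y ^ (d - Suc i) * x ^ i)"

lemma power_diff_eq_power_quot: "x ^ d - y ^ d = (x - y) * power_quot d x y"
  unfolding power_quot_def by (rule power_diff_sumr2)

text \<open>Modulo \<open>x - y\<close> each of the \<open>d\<close> summands becomes
  \<open>y ^ (d - 1)\<close>, so the difference quotient becomes the derivative of the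
  \<open>d\<close>-th power at \<open>y\<close>.\<close>

lemma power_quot_cong: "x - y dvd power_quot d x y - of_nat d * y ^ (d - 1)"
proof -
  have "(\<Sum>i<d. y ^ (d - 1)) = (\<Sum>i<d. y ^ (d - Suc i) * y ^ i)"
    by (rule sum.cong) (auto simp flip: power_add)
  hence "power_quot d x y - of_nat d * y ^ (d - 1) = (\<Sum>i<d. y ^ (d - Suc i) * (x ^ i - y ^ i))"
    by (simp add: power_quot_def algebra_simps sum_subtractf)
  also have "x - y dvd \<dots>"
    by (intro dvd_sum dvd_mult) (simp add: power_diff_eq_power_quot)
  finally show ?thesis .
qed

lemma orbit_diff_Suc:
  "orbit_diff d (Suc m) k =
     orbit_diff d m k * power_quot d (crit_orbit d (m + k)) (crit_orbit d m)"
  by (simp add: orbit_diff_def crit_orbit_Suc flip: power_diff_eq_power_quot)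

lemma orbit_diff_dvd_shift: "orbit_diff d m k dvd orbit_diff d (m + s) k"
  by (induction s) (auto simp: orbit_diff_Suc)

lemma dvd_orbit_diff_mono:
  assumes "\<pi> dvd orbit_diff d m k" "m \<le> m'"
  shows "\<pi> dvd orbit_diff d m' k"
  using assms orbit_diff_dvd_shift[of d m k "m' - m"] by (auto intro: dvd_trans)

lemma dvd_orbit_diff_mult:
  assumes "\<pi> dvd orbit_diff d m k"
  shows "\<pi> dvd orbit_diff d m (j * k)"
proof (induction j)
  case (Suc j)
  have "orbit_diff d m (Suc j * k) = orbit_diff d (m + j * k) k + orbit_diff d m (j * k)"
    using orbit_diff_add[of d m "j * k" k] by (simp add: add.commute)
  thus ?case using Suc dvd_orbit_diff_mono[OF assms, of "m + j * k"] by simp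
qed simp

text \<open>The first step multiplies \<open>D = orbit_diff d m k\<close> by a difference quotient,
  which lies in the ideal \<open>(d, D)\<close> by \<open>power_quot_cong\<close>. Further steps
  only contribute more factors.\<close>

lemma orbit_diff_shift_ideal:
  assumes "s \<ge> 1"
  shows "\<exists>p q. orbit_diff d (m + s) k = orbit_diff d m k * (of_nat d * p + orbit_diff d m k * q)"
proof -
  let ?x = "crit_orbit d (m + k)" and ?y = "crit_orbit d m"
  obtain q where "power_quot d ?x ?y - of_nat d * ?y ^ (d - 1) = orbit_diff d m k * q"
    using power_quot_cong[of ?x ?y d] unfolding orbit_diff_def by (auto elim: dvdE)
  hence q: "orbit_diff d (Suc m) k =
      orbit_diff d m k * (of_nat d * ?y ^ (d - 1) + orbit_diff d m k * q)"
    unfolding orbit_diff_Suc by (simp add: algebra_simps)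
  have "orbit_diff d (Suc m) k dvd orbit_diff d (m + s) k"
    using orbit_diff_dvd_shift[of d "Suc m" k "s - 1"] assms by simp
  then obtain h where "orbit_diff d (m + s) k = orbit_diff d (Suc m) k * h" by auto
  hence "orbit_diff d (m + s) k =
      orbit_diff d m k * (of_nat d * (?y ^ (d - 1) * h) + orbit_diff d m k * (q * h))"
    unfolding q by (simp add: algebra_simps)
  thus ?thesis by blast
qed

text \<open>The difference over \<open>j * r\<close> steps telescopes into
  \<open>D = orbit_diff d m r\<close> and its shifts by \<open>r\<close>, \<open>2 * r\<close> and
  so on. By \<open>orbit_diff_shift_ideal\<close> each proper shift is \<open>D\<close> times an
  element of \<open>(d, D)\<close>.\<close>

lemma orbit_diff_mult_ideal:
  assumes "r \<ge> 1" "j \<ge> 1"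
  shows "\<exists>p q. orbit_diff d m (j * r) =
           orbit_diff d m r * (1 + of_nat d * p + orbit_diff d m r * q)"
  using assms(2)
proof (induction j rule: dec_induct)
  case base
  show ?case by (rule exI[of _ 0], rule exI[of _ 0]) simp
next
  case (step j)
  then obtain p q where pq: "orbit_diff d m (j * r) =
      orbit_diff d m r * (1 + of_nat d * p + orbit_diff d m r * q)" by blast
  have "j * r \<ge> 1" using step(1) assms(1) by simp
  from orbit_diff_shift_ideal[OF this] obtain p' q' where
    "orbit_diff d (m + j * r) r = orbit_diff d m r * (of_nat d * p' + orbit_diff d m r * q')" by blast
  moreover have "orbit_diff d m (Suc j * r) = orbit_diff d (m + j * r) r + orbit_diff d m (j * r)"
    using orbit_diff_add[of d m "j * r" r] by (simp add: add.commute)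
  ultimately have "orbit_diff d m (Suc j * r) =
      orbit_diff d m r * (1 + of_nat d * (p + p') + orbit_diff d m r * (q + q'))"
    using pq by (simp add: algebra_simps)
  thus ?case by blast
qed

lemma crit_orbit_monic:
  assumes "d \<ge> 2"
  shows "lead_coeff (crit_orbit d (Suc k)) = 1 \<and> degree (crit_orbit d (Suc k)) = d ^ k"
proof (induction k)
  case 0
  have "d > 0" using assms by simp
  thus ?case by (simp add: crit_orbit_Suc zero_power)
next
  case (Suc k)
  let ?a = "crit_orbit d (Suc k)"
  have a0: "?a \<noteq> 0" using Suc by auto
  have deg: "degree (?a ^ d) = d ^ Suc k" using Suc by (simp add: degree_power_eq a0)
  have "d ^ Suc k > 1" using assms by (intro one_less_power) auto
  hence less: "degree [:0, 1 :: int:] < degree (?a ^ d)" unfolding deg by simp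
  have "degree (?a ^ d + [:0, 1:]) = degree (?a ^ d)"
    by (rule degree_add_eq_left[OF less])
  moreover have "lead_coeff (?a ^ d + [:0, 1:]) = lead_coeff (?a ^ d)"
    by (rule lead_coeff_add_le[OF less, unfolded add.commute[of "[:0,1:]"]])
  moreover have "lead_coeff (?a ^ d) = 1" using Suc by (metis lead_coeff_power power_one)
  ultimately show ?case unfolding crit_orbit_Suc[of d "Suc k"] using deg by metis
qed

lemma lead_coeff_orbit_diff:
  assumes "d \<ge> 2" "k \<ge> 1"
  shows "lead_coeff (orbit_diff d m k) = 1"
proof -
  obtain j where j: "m + k = Suc j" using assms(2) by (cases "m + k") auto
  have less: "degree (crit_orbit d m) < degree (crit_orbit d (m + k))"
  proof (cases m)
    case 0
    thus ?thesis using j crit_orbit_monic[OF assms(1), of j] assms(1) by simp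
  next
    case (Suc i)
    hence "i < j" using j assms(2) by simp
    thus ?thesis using j Suc crit_orbit_monic[OF assms(1)] assms(1)
      by (simp add: power_strict_increasing_iff)
  qed
  have "lead_coeff (crit_orbit d (m + k) + - crit_orbit d m) = lead_coeff (crit_orbit d (m + k))"
    using lead_coeff_add_le[of "- crit_orbit d m" "crit_orbit d (m + k)"] less
    by (simp only: add.commute degree_minus)
  thus ?thesis unfolding orbit_diff_def using j crit_orbit_monic[OF assms(1), of j]
    by (metis uminus_add_conv_diff add.commute)
qed

lemma orbit_diff_nonzero: "d \<ge> 2 \<Longrightarrow> k \<ge> 1 \<Longrightarrow> orbit_diff d m k \<noteq> 0"
  using lead_coeff_orbit_diff[of d k m] by auto

text \<open>Modulo \<open>\<pi>\<close> the orbit is eventually periodic, and \<open>r\<close> is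
  its least period. Far enough along the orbit \<open>r\<close> and \<open>k\<close> are both
  periods, so the remainder of \<open>k\<close> by \<open>r\<close> is one as well and must vanish
  by minimality.\<close>

lemma dvd_orbit_diff_exact_period:
  assumes "\<exists>m k. k \<ge> 1 \<and> \<pi> dvd orbit_diff d m k"
  obtains r where "r \<ge> 1"
    and "\<And>m k. k \<ge> 1 \<Longrightarrow> \<pi> dvd orbit_diff d m k \<Longrightarrow> r dvd k"
    and "\<And>m k. k \<ge> 1 \<Longrightarrow> \<pi> dvd orbit_diff d m k \<Longrightarrow> \<pi> dvd orbit_diff d m r"
proof -
  let ?P = "\<lambda>k. k \<ge> 1 \<and> (\<exists>m. \<pi> dvd orbit_diff d m k)"
  define r where "r = (LEAST k. ?P k)"
  have "?P r" unfolding r_def by (rule LeastI_ex) (use assms in blast)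
  then obtain m0 where r: "r \<ge> 1" "\<pi> dvd orbit_diff d m0 r" by blast
  have dv: "r dvd k" if k: "k \<ge> 1" "\<pi> dvd orbit_diff d m k" for m k
  proof (rule ccontr)
    assume nd: "\<not> r dvd k"
    define M where "M = max m m0"
    define s where "s = k mod r"
    have "k = s + (k div r) * r" by (simp add: s_def)
    moreover have "\<pi> dvd orbit_diff d M k" "\<pi> dvd orbit_diff d (M + s) ((k div r) * r)"
      using k r dvd_orbit_diff_mono[of \<pi> d m k M] dvd_orbit_diff_mono[of \<pi> d m0 r "M + s"]
      by (auto simp: M_def intro!: dvd_orbit_diff_mult)
    ultimately have "\<pi> dvd orbit_diff d M s"
      using orbit_diff_add[of d M s "(k div r) * r"] by (metis dvd_add_right_iff)
    moreover have "s \<ge> 1" "s < r" using nd r(1) by (auto simp: s_def dvd_eq_mod_eq_0 Suc_le_eq)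
    ultimately show False using not_less_Least[of s ?P] by (auto simp: r_def)
  qed
  have "\<pi> dvd orbit_diff d m r" if k: "k \<ge> 1" "\<pi> dvd orbit_diff d m k" for m k
  proof -
    \<comment> \<open>\<open>N\<close> is a multiple of the period \<open>k\<close>, so it is a
      period from index \<open>m\<close> on, and \<open>m + N\<close> is late enough for
      \<open>r\<close> to be a period there. Comparing the two ways from index \<open>m\<close> to
      \<open>m + r + N\<close> carries the period \<open>r\<close> back to \<open>m\<close>.\<close>
    define N where "N = m0 * k"
    have N: "\<pi> dvd orbit_diff d m N" "N \<ge> m0"
      using dvd_orbit_diff_mult[OF k(2)] k(1) by (auto simp: N_def)
    have "\<pi> dvd orbit_diff d (m + N) r" using dvd_orbit_diff_mono[OF r(2)] N(2) by simp
    moreover have "\<pi> dvd orbit_diff d (m + r) N" using dvd_orbit_diff_mono[OF N(1)] by simp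
    moreover have "orbit_diff d (m + r) N + orbit_diff d m r = orbit_diff d (m + N) r + orbit_diff d m N"
      using orbit_diff_add[of d m r N] orbit_diff_add[of d m N r] by (simp add: add.commute)
    ultimately show ?thesis using N(1) by (metis dvd_add dvd_add_right_iff)
  qed
  thus ?thesis using that r(1) dv by blast
qed

text \<open>By \<open>orbit_diff_mult_ideal\<close>, passing from the exact period \<open>r\<close>
  to a multiple of it adds a cofactor \<open>1 + d p + D q\<close>. If \<open>\<pi>\<close> divides
  \<open>D\<close>, this is \<open>1 + d p\<close> modulo \<open>\<pi>\<close>, which
  \<open>\<pi>\<close> does not divide. It matters below that \<open>r\<close> is the same for all
  \<open>m\<close>.\<close>

lemma multiplicity_orbit_diff:
  fixes \<pi> :: "int poly"
  assumes pi: "prime_elem \<pi>" and d: "d = CARD('p :: prime_card)"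
  obtains r v where "\<And>m k. k \<ge> 1 \<Longrightarrow> multiplicity \<pi> (orbit_diff d m k) = (if r dvd k then v m else 0)"
proof (cases "\<exists>m k. k \<ge> 1 \<and> \<pi> dvd orbit_diff d m k")
  case False
  show ?thesis
    \<comment> \<open>The value 0 stands for the absence of a period: it divides no positive
      \<open>k\<close>.\<close>
    by (rule that[of 0 "\<lambda>_. 0"]) (use False in \<open>auto simp: not_dvd_imp_multiplicity_0\<close>)
next
  case True
  have d2: "d \<ge> 2" unfolding d using prime_card[where ?'a = 'p] prime_ge_2_nat by blast
  obtain r where r: "r \<ge> 1" "\<And>m k. k \<ge> 1 \<Longrightarrow> \<pi> dvd orbit_diff d m k \<Longrightarrow> r dvd k"
    "\<And>m k. k \<ge> 1 \<Longrightarrow> \<pi> dvd orbit_diff d m k \<Longrightarrow> \<pi> dvd orbit_diff d m r"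
    by (rule dvd_orbit_diff_exact_period[OF True]) blast
  show ?thesis
  proof (rule that[of r "\<lambda>m. multiplicity \<pi> (orbit_diff d m r)"])
    fix m k :: nat assume k: "k \<ge> 1"
    show "multiplicity \<pi> (orbit_diff d m k) =
        (if r dvd k then multiplicity \<pi> (orbit_diff d m r) else 0)"
    proof (cases "\<pi> dvd orbit_diff d m r \<and> r dvd k")
      case False
      hence "\<not> \<pi> dvd orbit_diff d m k" using r(2,3) k by blast
      thus ?thesis using False by (auto simp: not_dvd_imp_multiplicity_0)
    next
      case True
      then obtain j where j: "k = j * r" by (metis dvdE mult.commute)
      hence "j \<ge> 1" using k by (cases j) auto
      from orbit_diff_mult_ideal[OF r(1) this] obtain p q where pq:
        "orbit_diff d m k = orbit_diff d m r * (1 + of_nat d * p + orbit_diff d m r * q)"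
        unfolding j by blast
      have "\<not> \<pi> dvd 1 + of_nat d * p"
        unfolding d by (rule not_dvd_1_mod_card[of "orbit_diff d m r"])
          (use pi True lead_coeff_orbit_diff[OF d2 r(1)] in \<open>auto simp: prime_elem_def\<close>)
      hence nd: "\<not> \<pi> dvd 1 + of_nat d * p + orbit_diff d m r * q"
        using True by (meson dvd_add_left_iff dvd_mult2)
      have "multiplicity \<pi> (orbit_diff d m k) = multiplicity \<pi> (orbit_diff d m r)"
        unfolding pq using nd pi orbit_diff_nonzero[OF d2 r(1)]
        by (subst prime_elem_multiplicity_mult_distrib) (auto simp: not_dvd_imp_multiplicity_0)
      thus ?thesis using True by simp
    qed
  qed
qed

section \<open>Rigid divisibility and Moebius quotients inside the ring\<close>

definition moebius_rigid :: "nat \<Rightarrow> (nat \<Rightarrow> 'a :: factorial_semiring) \<Rightarrow> bool" where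
  "moebius_rigid n f \<longleftrightarrow> n > 0 \<and> (\<forall>k. k dvd n \<longrightarrow> f k \<noteq> 0) \<and>
     (\<forall>\<pi>. prime_elem \<pi> \<longrightarrow>
       (\<exists>r v. \<forall>k. k dvd n \<longrightarrow> multiplicity \<pi> (f k) = (if r dvd k then v else 0)))"

definition moebius_quot :: "nat \<Rightarrow> (nat \<Rightarrow> 'a :: {comm_monoid_mult, divide}) \<Rightarrow> 'a" where
  "moebius_quot n f = moebius_num n f div moebius_den n f"

lemma moebius_num_den_nonzero:
  assumes "moebius_rigid n f"
  shows "moebius_num n f \<noteq> 0" "moebius_den n f \<noteq> 0"
  using assms by (auto simp: moebius_rigid_def moebius_num_def moebius_den_def)

lemma moebius_quot_mult_den:
  assumes "moebius_rigid n f"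
  shows "moebius_quot n f * moebius_den n f = moebius_num n f"
proof -
  have "moebius_den n f dvd moebius_num n f"
  proof (rule multiplicity_le_imp_dvd)
    fix \<pi> :: 'a assume "prime \<pi>"
    hence pi: "prime_elem \<pi>" by simp
    then obtain r v where "\<And>k. k dvd n \<Longrightarrow> multiplicity \<pi> (f k) = (if r dvd k then v else 0)"
      using assms unfolding moebius_rigid_def by blast
    from multiplicity_moebius_num_den[OF _ pi _ this] assms
    show "multiplicity \<pi> (moebius_den n f) \<le> multiplicity \<pi> (moebius_num n f)"
      unfolding moebius_rigid_def by simp
  qed (use moebius_num_den_nonzero[OF assms] in simp)
  thus ?thesis by (simp add: moebius_quot_def)
qed

lemma moebius_quot_nonzero: "moebius_rigid n f \<Longrightarrow> moebius_quot n f \<noteq> 0"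
  using moebius_quot_mult_den[of n f] moebius_num_den_nonzero[of n f] by auto

lemma multiplicity_moebius_quot:
  assumes "moebius_rigid n f" "prime_elem \<pi>"
    and "\<And>k. k dvd n \<Longrightarrow> multiplicity \<pi> (f k) = (if r dvd k then v else 0)"
  shows "multiplicity \<pi> (moebius_quot n f) = (if n = r then v else 0)"
proof -
  have "multiplicity \<pi> (moebius_num n f) =
      multiplicity \<pi> (moebius_quot n f) + multiplicity \<pi> (moebius_den n f)"
    using moebius_quot_mult_den[OF assms(1)] moebius_quot_nonzero[OF assms(1)]
      moebius_num_den_nonzero[OF assms(1)] assms(2)
    by (metis prime_elem_multiplicity_mult_distrib)
  moreover have "multiplicity \<pi> (moebius_num n f) =
      multiplicity \<pi> (moebius_den n f) + (if n = r then v else 0)"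
    using assms by (intro multiplicity_moebius_num_den) (auto simp: moebius_rigid_def)
  ultimately show ?thesis by simp
qed

text \<open>A prime of the quotient has \<open>r = n\<close>, so it does not divide
  \<open>f k\<close> for a proper divisor \<open>k\<close>. The two factors thus share no primes,
  and each prime occurs in \<open>f n\<close> at least as often as in either of them.\<close>

lemma mult_moebius_quot_dvd:
  assumes "moebius_rigid n f" "k dvd n" "k \<noteq> n"
  shows "f k * moebius_quot n f dvd f n"
proof (rule multiplicity_le_imp_dvd)
  have nz: "f k \<noteq> 0" "moebius_quot n f \<noteq> 0"
    using assms moebius_quot_nonzero[OF assms(1)] by (auto simp: moebius_rigid_def)
  thus "f k * moebius_quot n f \<noteq> 0" by simp
  fix \<pi> :: 'a assume "prime \<pi>"
  hence pi: "prime_elem \<pi>" by simp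
  then obtain r v where rv: "\<And>k. k dvd n \<Longrightarrow> multiplicity \<pi> (f k) = (if r dvd k then v else 0)"
    using assms unfolding moebius_rigid_def by blast
  have "k < n" using assms by (auto simp: moebius_rigid_def dest!: dvd_imp_le)
  hence "\<not> n dvd k" using assms by (auto simp: moebius_rigid_def dest: dvd_antisym)
  thus "multiplicity \<pi> (f k * moebius_quot n f) \<le> multiplicity \<pi> (f n)"
    using rv assms multiplicity_moebius_quot[OF assms(1) pi rv] nz pi
    by (auto simp: prime_elem_multiplicity_mult_distrib dest: dvd_trans)
qed

lemma moebius_quot_dvd:
  assumes "moebius_rigid n f"
  shows "moebius_quot n f dvd f n"
proof (rule multiplicity_le_imp_dvd)
  fix \<pi> :: 'a assume "prime \<pi>"
  hence pi: "prime_elem \<pi>" by simp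
  then obtain r v where rv: "\<And>k. k dvd n \<Longrightarrow> multiplicity \<pi> (f k) = (if r dvd k then v else 0)"
    using assms unfolding moebius_rigid_def by blast
  show "multiplicity \<pi> (moebius_quot n f) \<le> multiplicity \<pi> (f n)"
    using rv multiplicity_moebius_quot[OF assms pi rv] by auto
qed (use moebius_quot_nonzero[OF assms] in simp)

lemma to_fract_prod: "to_fract (prod f A) = (\<Prod>x\<in>A. to_fract (f x))"
  by (induction A rule: infinite_finite_induct) auto

lemma to_fract_power: "to_fract (x ^ n) = to_fract x ^ n"
  by (induction n) auto

lemma to_fract_moebius_quot:
  fixes f :: "nat \<Rightarrow> 'a :: {factorial_ring_gcd, semiring_gcd_mult_normalize}"
  assumes "moebius_rigid n f"
  shows "to_fract (moebius_quot n f) = (\<Prod>k | k dvd n. to_fract (f k) powi moebius (n div k))"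
proof -
  have n: "n > 0" using assms by (simp add: moebius_rigid_def)
  have "to_fract (moebius_quot n f) * to_fract (moebius_den n f) = to_fract (moebius_num n f)"
    by (simp add: moebius_quot_mult_den[OF assms] flip: to_fract_mult)
  hence "to_fract (moebius_quot n f) = to_fract (moebius_num n f) / to_fract (moebius_den n f)"
    using moebius_num_den_nonzero[OF assms] by (simp add: field_simps)
  also have "\<dots> = moebius_num n (\<lambda>k. to_fract (f k)) / moebius_den n (\<lambda>k. to_fract (f k))"
    unfolding moebius_num_def moebius_den_def by (simp add: to_fract_prod)
  finally show ?thesis by (simp add: prod_powi_moebius[OF n])
qed

section \<open>The Misiurewicz polynomials as Moebius quotients\<close>

lemma power_quot_mult_common:
  assumes "d \<ge> 1"
  shows "power_quot d (z * x) (z * y) = z ^ (d - 1) * power_quot d x y"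
proof -
  have "(z * y) ^ (d - Suc i) * (z * x) ^ i = z ^ (d - 1) * (y ^ (d - Suc i) * x ^ i)" if "i < d" for i
  proof -
    have "(z * y) ^ (d - Suc i) * (z * x) ^ i = (z ^ (d - Suc i) * z ^ i) * (y ^ (d - Suc i) * x ^ i)"
      by (simp add: power_mult_distrib algebra_simps)
    also have "z ^ (d - Suc i) * z ^ i = z ^ (d - 1)" using that by (simp flip: power_add)
    finally show ?thesis .
  qed
  thus ?thesis unfolding power_quot_def by (simp add: sum_distrib_left)
qed

lemma crit_orbit_dvd: "k dvd j \<Longrightarrow> crit_orbit d k dvd crit_orbit d j"
  using dvd_orbit_diff_mult[of "crit_orbit d k" d 0 k] by (auto elim!: dvdE simp: mult.commute)

definition excess_exp :: "nat \<Rightarrow> nat \<Rightarrow> nat \<Rightarrow> nat" where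
  "excess_exp d l n = (if n dvd l then d - 1 else 0)"

text \<open>Write \<open>a\<^sub>k\<close> for the critical orbit and \<open>l = m - 1\<close>. This is the base
  \<open>(a\<^sub>m\<^sub>+\<^sub>k - a\<^sub>m) / (a\<^sub>l\<^sub>+\<^sub>k - a\<^sub>l)\<close> of the product \<open>F\<^sub>d\<^sub>,\<^sub>m\<^sub>,\<^sub>n\<close>, divided by \<open>a\<^sub>k\<^bsup>d-1\<^esup>\<close> if
  \<open>n\<close> divides \<open>l\<close>, since \<open>F\<^sub>d\<^sub>,\<^sub>1\<^sub>,\<^sub>n\<close> is the product of the \<open>a\<^sub>k\<^bsup>(d-1) \<mu>(n/k)\<^esup>\<close>.\<close>

definition misiurewicz_factor :: "nat \<Rightarrow> nat \<Rightarrow> nat \<Rightarrow> nat \<Rightarrow> int poly" where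
  "misiurewicz_factor d l n k =
     (if n dvd l then power_quot d (crit_orbit d (l + k) div crit_orbit d k) (crit_orbit d l div crit_orbit d k)
      else power_quot d (crit_orbit d (l + k)) (crit_orbit d l))"

text \<open>If \<open>n\<close> divides \<open>l\<close>, then \<open>a_(l+k)\<close> and
  \<open>a_l\<close> are multiples of \<open>a_k\<close>, and homogeneity of
  \<open>power_quot\<close> splits off \<open>a_k ^ (d - 1)\<close>. Multiplicities, reductions and
  leading coefficients of the factor are all read off from this equation.\<close>

lemma misiurewicz_factor_mult:
  assumes "d \<ge> 2" "k dvd n"
  shows "misiurewicz_factor d l n k * (orbit_diff d l k * crit_orbit d k ^ excess_exp d l n) =
         orbit_diff d (Suc l) k"
proof (cases "n dvd l")
  case False
  thus ?thesis by (simp add: misiurewicz_factor_def excess_exp_def orbit_diff_Suc mult.commute)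
next
  case True
  hence "k dvd l" "k dvd l + k" using assms(2) by (auto dest: dvd_trans)
  hence "crit_orbit d k * (crit_orbit d (l + k) div crit_orbit d k) = crit_orbit d (l + k)"
    "crit_orbit d k * (crit_orbit d l div crit_orbit d k) = crit_orbit d l"
    using crit_orbit_dvd by (auto intro!: dvd_mult_div_cancel)
  hence "power_quot d (crit_orbit d (l + k)) (crit_orbit d l) =
      crit_orbit d k ^ (d - 1) * misiurewicz_factor d l n k"
    using power_quot_mult_common[of d "crit_orbit d k" "crit_orbit d (l + k) div crit_orbit d k"
      "crit_orbit d l div crit_orbit d k"] assms True by (simp add: misiurewicz_factor_def)
  thus ?thesis using True by (simp add: excess_exp_def orbit_diff_Suc ac_simps)
qed

lemma prime_card_ge_2: "CARD('p :: prime_card) \<ge> 2"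
  using prime_card[where ?'a = 'p] prime_ge_2_nat by blast

lemma moebius_rigid_crit_orbit:
  assumes "d = CARD('p :: prime_card)" "n \<ge> 1"
  shows "moebius_rigid n (crit_orbit d)"
  unfolding moebius_rigid_def
proof (intro conjI allI impI)
  show "n > 0" using assms by simp
  fix k assume "k dvd n"
  hence "k \<ge> 1" using assms by (auto intro: Suc_leI)
  thus "crit_orbit d k \<noteq> 0"
    using orbit_diff_nonzero[of d k 0] prime_card_ge_2[where ?'p = 'p] assms by simp
next
  fix \<pi> :: "int poly" assume pi: "prime_elem \<pi>"
  obtain r v where rv: "\<And>m k. k \<ge> 1 \<Longrightarrow> multiplicity \<pi> (orbit_diff d m k) = (if r dvd k then v m else 0)"
    using multiplicity_orbit_diff[OF pi assms(1)] by blast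
  have "multiplicity \<pi> (crit_orbit d k) = (if r dvd k then v 0 else 0)" if "k dvd n" for k
    using rv[of k 0] that assms(2) by (cases "k = 0") auto
  thus "\<exists>r v. \<forall>k. k dvd n \<longrightarrow> multiplicity \<pi> (crit_orbit d k) = (if r dvd k then v else 0)"
    by blast
qed

lemma moebius_rigid_misiurewicz_factor:
  assumes d: "d = CARD('p :: prime_card)" and "n \<ge> 1"
  shows "moebius_rigid n (misiurewicz_factor d l n)"
  unfolding moebius_rigid_def
proof (intro conjI allI impI)
  have d2: "d \<ge> 2" using prime_card_ge_2[where ?'p = 'p] d by simp
  show "n > 0" using assms by simp
  have k1: "k \<ge> 1" if "k dvd n" for k using that assms(2) by (cases "k = 0") auto
  show nz: "misiurewicz_factor d l n k \<noteq> 0" if "k dvd n" for k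
    using misiurewicz_factor_mult[OF d2 that, of l] orbit_diff_nonzero[OF d2 k1[OF that], of "Suc l"]
    by auto
  fix \<pi> :: "int poly" assume pi: "prime_elem \<pi>"
  obtain r v where rv: "\<And>m k. k \<ge> 1 \<Longrightarrow> multiplicity \<pi> (orbit_diff d m k) = (if r dvd k then v m else 0)"
    using multiplicity_orbit_diff[OF pi assms(1)] by blast
  \<comment> \<open>Multiplicities add up in \<open>misiurewicz_factor_mult\<close>, and all three
    differences there share the same \<open>r\<close>. When \<open>r\<close> divides
    \<open>k\<close> this makes the subtraction of natural numbers exact.\<close>
  have "multiplicity \<pi> (misiurewicz_factor d l n k) =
      (if r dvd k then v (Suc l) - (v l + excess_exp d l n * v 0) else 0)" if k: "k dvd n" for k
  proof -
    have nz': "orbit_diff d l k \<noteq> 0" "crit_orbit d k \<noteq> 0"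
      using orbit_diff_nonzero[OF d2 k1[OF k]] orbit_diff_nonzero[OF d2 k1[OF k], of 0] by auto
    have "multiplicity \<pi> (misiurewicz_factor d l n k) + (multiplicity \<pi> (orbit_diff d l k)
        + excess_exp d l n * multiplicity \<pi> (orbit_diff d 0 k)) = multiplicity \<pi> (orbit_diff d (Suc l) k)"
      using nz[OF k] nz' pi
      by (simp add: prime_elem_multiplicity_mult_distrib prime_elem_multiplicity_power_distrib
        flip: misiurewicz_factor_mult[OF d2 k, of l])
    thus ?thesis using rv[OF k1[OF k], of l] rv[OF k1[OF k], of "Suc l"] rv[OF k1[OF k], of 0]
      by (auto split: if_splits)
  qed
  thus "\<exists>r v. \<forall>k. k dvd n \<longrightarrow> multiplicity \<pi> (misiurewicz_factor d l n k) = (if r dvd k then v else 0)"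
    by blast
qed

lemma misiurewicz_polyI: "to_fract p = misiurewicz_fract d m n \<Longrightarrow> misiurewicz_poly d m n = p"
  unfolding misiurewicz_poly_def by (rule the_equality, assumption) (metis to_fract_eq_iff)

lemma misiurewicz_poly_0:
  assumes "d = CARD('p :: prime_card)" "n \<ge> 1"
  shows "misiurewicz_poly d 0 n = moebius_quot n (crit_orbit d)"
  by (rule misiurewicz_polyI)
    (simp add: misiurewicz_fract_def to_fract_moebius_quot[OF moebius_rigid_crit_orbit[OF assms]])

lemma misiurewicz_poly_Suc:
  assumes d: "d = CARD('p :: prime_card)" and n: "n \<ge> 1" and l: "l \<ge> 1"
  shows "misiurewicz_poly d (Suc l) n = moebius_quot n (misiurewicz_factor d l n)"
proof (rule misiurewicz_polyI)
  have d2: "d \<ge> 2" using prime_card_ge_2[where ?'p = 'p] d by simp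
  have k1: "k \<ge> 1" if "k dvd n" for k using that n by (cases "k = 0") auto
  have F: "misiurewicz_F d (Suc j) n =
      (\<Prod>k | k dvd n. (to_fract (orbit_diff d (Suc j) k) / to_fract (orbit_diff d j k)) powi moebius (n div k))" for j
    unfolding misiurewicz_F_def orbit_diff_def by simp
  have eq: "to_fract (misiurewicz_factor d l n k) =
     to_fract (orbit_diff d (Suc l) k) / to_fract (orbit_diff d l k) / to_fract (crit_orbit d k) ^ excess_exp d l n"
    if k: "k dvd n" for k
    using orbit_diff_nonzero[OF d2 k1[OF k]] orbit_diff_nonzero[OF d2 k1[OF k], of 0]
    by (simp add: field_simps to_fract_power flip: misiurewicz_factor_mult[OF d2 k, of l])
  \<comment> \<open>As \<open>a_1\<close> is the variable itself, \<open>a_(1+k) - a_1\<close> is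
    \<open>a_k ^ d\<close>. Hence the bases of the product \<open>misiurewicz_F d 1 n\<close> are
    the powers \<open>a_k ^ (d - 1)\<close>.\<close>
  have eq1: "to_fract (orbit_diff d (Suc 0) k) / to_fract (orbit_diff d 0 k) = to_fract (crit_orbit d k) ^ (d - 1)"
    if k: "k dvd n" for k
  proof -
    have "orbit_diff d (Suc 0) k = crit_orbit d k ^ d"
      using d2 by (simp add: orbit_diff_def crit_orbit_Suc zero_power)
    also have "\<dots> = crit_orbit d k * crit_orbit d k ^ (d - 1)"
      using d2 by (simp flip: power_Suc)
    finally show ?thesis using orbit_diff_nonzero[OF d2 k1[OF k], of 0] by (simp add: to_fract_power)
  qed
  have "to_fract (moebius_quot n (misiurewicz_factor d l n)) =
      (\<Prod>k | k dvd n. to_fract (misiurewicz_factor d l n k) powi moebius (n div k))"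
    by (rule to_fract_moebius_quot[OF moebius_rigid_misiurewicz_factor[OF d n]])
  also have "\<dots> = misiurewicz_fract d (Suc l) n"
  proof (cases "n dvd l")
    case True
    have "misiurewicz_fract d (Suc l) n = misiurewicz_F d (Suc l) n / misiurewicz_F d (Suc 0) n"
      using True by (simp add: misiurewicz_fract_def)
    also have "\<dots> = (\<Prod>k | k dvd n. to_fract (misiurewicz_factor d l n k) powi moebius (n div k))"
      unfolding F prod_dividef[symmetric] power_int_divide_distrib[symmetric]
      by (rule prod.cong) (use True in \<open>auto simp: eq eq1[simplified] excess_exp_def\<close>)
    finally show ?thesis by simp
  next
    case False
    hence "misiurewicz_fract d (Suc l) n = misiurewicz_F d (Suc l) n"
      by (simp add: misiurewicz_fract_def)
    also have "\<dots> = (\<Prod>k | k dvd n. to_fract (misiurewicz_factor d l n k) powi moebius (n div k))"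
      unfolding F by (rule prod.cong) (use False in \<open>auto simp: eq excess_exp_def\<close>)
    finally show ?thesis by simp
  qed
  finally show "to_fract (moebius_quot n (misiurewicz_factor d l n)) = misiurewicz_fract d (Suc l) n" .
qed

section \<open>Reduction of the Misiurewicz polynomials modulo d\<close>

lemma CHAR_mod_ring_poly: "CHAR('p :: prime_card mod_ring poly) = CARD('p)"
proof (rule CHAR_eqI)
  show "of_nat CARD('p) = (0 :: 'p mod_ring poly)" by (simp add: of_nat_poly)
  fix x assume "of_nat x = (0 :: 'p mod_ring poly)"
  hence "of_nat x = (0 :: 'p mod_ring)" by (simp add: of_nat_poly)
  thus "CARD('p) dvd x" by (rule of_nat_0_mod_ring_dvd)
qed

lemma power_card_diff:
  fixes x y :: "'p :: prime_card mod_ring poly"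
  shows "(x - y) ^ CARD('p) = x ^ CARD('p) - y ^ CARD('p)"
proof -
  have "(x - y + y) ^ CARD('p) = (x - y) ^ CARD('p) + y ^ CARD('p)"
    by (rule freshmans_dream) (simp_all add: CHAR_mod_ring_poly prime_card)
  thus ?thesis by (simp add: algebra_simps)
qed

text \<open>In characteristic \<open>d\<close> the Frobenius map is additive, and the parameter
  cancels in a difference. So each step of the orbit raises the difference to the power
  \<open>d\<close>, starting from \<open>a_k\<close>.\<close>

lemma reduct_orbit_diff:
  assumes d: "d = CARD('p :: prime_card)"
  shows "(reduct (orbit_diff d m k) :: 'p mod_ring poly) = reduct (crit_orbit d k) ^ (d ^ m)"
proof (induction m)
  case (Suc m)
  have "(reduct (orbit_diff d (Suc m) k) :: 'p mod_ring poly) =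
      reduct (crit_orbit d (m + k)) ^ d - reduct (crit_orbit d m) ^ d"
    by (simp add: orbit_diff_def crit_orbit_Suc of_int_poly_hom.hom_minus of_int_poly_hom.hom_power)
  also have "\<dots> = reduct (orbit_diff d m k) ^ d"
    unfolding d power_card_diff[symmetric] by (simp add: orbit_diff_def of_int_poly_hom.hom_minus)
  finally show ?case using Suc by (simp add: power_mult[symmetric] mult.commute)
qed simp

text \<open>All terms of \<open>misiurewicz_factor_mult\<close> reduce to powers of the reduction of
  \<open>a_k\<close>; this is the exponent left for the factor. It is the same for every
  \<open>k\<close>, so it can be pulled out of the Moebius product.\<close>

definition reduction_exp :: "nat \<Rightarrow> nat \<Rightarrow> nat \<Rightarrow> nat" where
  "reduction_exp d l n = d ^ Suc l - (d ^ l + excess_exp d l n)"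

lemma reduction_exp_pos:
  assumes "d \<ge> 2" "l \<ge> 1"
  shows "d ^ l + excess_exp d l n < d ^ Suc l"
proof -
  have "d ^ l \<ge> d" using assms power_increasing[of 1 l d] by simp
  moreover have "d ^ Suc l = d ^ l + (d - 1) * d ^ l" using assms(1) by (simp add: algebra_simps)
  moreover have "d - 1 < (d - 1) * d ^ l" using assms \<open>d ^ l \<ge> d\<close> by simp
  ultimately show ?thesis unfolding excess_exp_def by (simp split: if_splits)
qed

lemma reduct_crit_orbit_nonzero:
  assumes d: "d = CARD('p :: prime_card)" and "k \<ge> 1"
  shows "(reduct (crit_orbit d k) :: 'p mod_ring poly) \<noteq> 0"
proof -
  obtain j where "k = Suc j" using assms(2) by (cases k) auto
  hence "lead_coeff (crit_orbit d k) = 1"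
    using crit_orbit_monic[of d j] prime_card_ge_2[where ?'p = 'p] d by metis
  hence "poly.coeff (reduct (crit_orbit d k) :: 'p mod_ring poly) (degree (crit_orbit d k)) = 1" by simp
  thus ?thesis by (metis Polynomial.coeff_0 zero_neq_one)
qed

lemma reduct_misiurewicz_factor:
  assumes d: "d = CARD('p :: prime_card)" and "k dvd n" "n \<ge> 1" "l \<ge> 1"
  shows "(reduct (misiurewicz_factor d l n k) :: 'p mod_ring poly) =
           reduct (crit_orbit d k) ^ reduction_exp d l n"
proof -
  have d2: "d \<ge> 2" using prime_card_ge_2[where ?'p = 'p] d by simp
  have "k \<ge> 1" using assms by (cases "k = 0") auto
  note nz = reduct_crit_orbit_nonzero[OF d this]
  let ?A = "reduct (crit_orbit d k) :: 'p mod_ring poly"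
  let ?s = "d ^ l + excess_exp d l n"
  have "reduct (misiurewicz_factor d l n k * (orbit_diff d l k * crit_orbit d k ^ excess_exp d l n)) =
      (reduct (orbit_diff d (Suc l) k) :: 'p mod_ring poly)"
    by (simp only: misiurewicz_factor_mult[OF d2 assms(2)])
  hence "reduct (misiurewicz_factor d l n k) * ?A ^ ?s = ?A ^ (d ^ Suc l)"
    by (simp only: of_int_poly_hom.hom_mult of_int_poly_hom.hom_power reduct_orbit_diff[OF d] power_add)
  also have "\<dots> = ?A ^ reduction_exp d l n * ?A ^ ?s"
    using reduction_exp_pos[OF d2 assms(4), of n] by (simp add: reduction_exp_def flip: power_add)
  finally show ?thesis using nz by simp
qed

text \<open>Numerator and denominator are reduced separately, where the products can be compared
  factor by factor. The reduced denominator is nonzero and cancels.\<close>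

lemma reduct_misiurewicz_quot:
  assumes d: "d = CARD('p :: prime_card)" and n: "n \<ge> 1" and l: "l \<ge> 1"
  shows "(reduct (moebius_quot n (misiurewicz_factor d l n)) :: 'p mod_ring poly) =
           reduct (moebius_quot n (crit_orbit d)) ^ reduction_exp d l n"
proof -
  let ?e = "reduction_exp d l n" let ?T = "misiurewicz_factor d l n" let ?a = "crit_orbit d"
  let ?D = "reduct (moebius_den n ?a) :: 'p mod_ring poly"
  have num: "reduct (moebius_num n ?T) = (reduct (moebius_num n ?a) ^ ?e :: 'p mod_ring poly)"
    and den: "reduct (moebius_den n ?T) = ?D ^ ?e"
    unfolding moebius_num_def moebius_den_def of_int_poly_hom.hom_prod prod_power_distrib
    using reduct_misiurewicz_factor[OF d _ n l] by (auto intro!: prod.cong)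
  have "?D \<noteq> 0"
    unfolding moebius_den_def of_int_poly_hom.hom_prod
    using n reduct_crit_orbit_nonzero[OF d] by (auto simp: Suc_le_eq intro!: Nat.gr0I)
  moreover have "reduct (moebius_quot n ?T) * ?D ^ ?e = reduct (moebius_num n ?T)"
    unfolding den[symmetric] of_int_poly_hom.hom_mult[symmetric]
      moebius_quot_mult_den[OF moebius_rigid_misiurewicz_factor[OF d n]] ..
  moreover have "reduct (moebius_num n ?T) = reduct (moebius_quot n ?a) ^ ?e * ?D ^ ?e"
    unfolding num power_mult_distrib[symmetric] of_int_poly_hom.hom_mult[symmetric]
      moebius_quot_mult_den[OF moebius_rigid_crit_orbit[OF d n]] ..
  ultimately show ?thesis by simp
qed

lemma pderiv_reduct_crit_orbit:
  assumes d: "d = CARD('p :: prime_card)" and "n \<ge> 1"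
  shows "pderiv (reduct (crit_orbit d n) :: 'p mod_ring poly) = 1"
proof -
  obtain j where j: "n = Suc j" using assms(2) by (cases n) auto
  obtain e where e: "d = Suc e" using prime_card_ge_2[where ?'p = 'p] d by (metis not0_implies_Suc not_numeral_le_zero)
  let ?A = "reduct (crit_orbit d j) :: 'p mod_ring poly"
  have "(of_nat (Suc e) :: 'p mod_ring) = 0" using e d by (metis of_nat_card_eq_0)
  hence "pderiv (?A ^ d) = 0" unfolding e pderiv_power_Suc by (simp del: of_nat_Suc)
  moreover have "reduct (crit_orbit d n) = ?A ^ d + [:0, 1:]"
    by (simp add: j crit_orbit_Suc of_int_poly_hom.hom_add of_int_poly_hom.hom_power)
  ultimately show ?thesis by (simp add: pderiv_add pderiv_pCons)
qed

text \<open>If \<open>g * g\<close> divided the reduction, \<open>g\<close> would divide its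
  derivative, which is 1.\<close>

lemma square_not_dvd_reduct_crit_orbit:
  assumes d: "d = CARD('p :: prime_card)" and "n \<ge> 1" "\<not> g dvd 1"
  shows "\<not> g * g dvd (reduct (crit_orbit d n) :: 'p mod_ring poly)"
proof
  assume "g * g dvd (reduct (crit_orbit d n) :: 'p mod_ring poly)"
  then obtain h where h: "reduct (crit_orbit d n) = g * (g * h)" by (metis dvdE mult.assoc)
  have "pderiv (reduct (crit_orbit d n)) = g * pderiv (g * h) + (g * h) * pderiv g"
    unfolding h by (rule pderiv_mult)
  hence "g dvd pderiv (reduct (crit_orbit d n))" by simp
  thus False using pderiv_reduct_crit_orbit[OF assms(1,2)] assms(3) by simp
qed

lemma reduct_dvd: "p dvd q \<Longrightarrow> reduct p dvd reduct q"
  by (auto elim!: dvdE simp: of_int_poly_hom.hom_mult)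

text \<open>Otherwise \<open>mult_moebius_quot_dvd\<close> would give the square of \<open>g\<close>
  as a divisor of the reduction of \<open>a_n\<close>. So \<open>n\<close> is the only divisor of
  \<open>n\<close> at which \<open>g\<close> can occur.\<close>

lemma not_dvd_reduct_crit_orbit_proper:
  fixes g :: "'p :: prime_card mod_ring poly"
  assumes d: "d = CARD('p)" and n: "n \<ge> 1" and g: "\<not> g dvd 1"
    and dvd: "g dvd reduct (moebius_quot n (crit_orbit d))" and k: "k dvd n" "k \<noteq> n"
  shows "\<not> g dvd reduct (crit_orbit d k)"
proof
  assume "g dvd reduct (crit_orbit d k)"
  hence "g * g dvd reduct (crit_orbit d k) * reduct (moebius_quot n (crit_orbit d))"
    using dvd by (rule mult_dvd_mono)
  also have "\<dots> dvd reduct (crit_orbit d n)"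
    using reduct_dvd[OF mult_moebius_quot_dvd[OF moebius_rigid_crit_orbit[OF d n] k]]
    by (simp add: of_int_poly_hom.hom_mult)
  finally show False using square_not_dvd_reduct_crit_orbit[OF d n g] by blast
qed

section \<open>The factor of index n at a prime g modulo d\<close>

lemma crit_orbit_add_cong: "crit_orbit d i dvd crit_orbit d (i + k) - crit_orbit d k"
  using dvd_orbit_diff_mono[of "crit_orbit d i" d 0 i k] by (simp add: orbit_diff_def add.commute)

lemma reduct_crit_orbit_add_dvd_iff:
  fixes g :: "'p :: prime_card mod_ring poly"
  assumes "g dvd reduct (crit_orbit d i)"
  shows "g dvd reduct (crit_orbit d (i + k)) \<longleftrightarrow> g dvd reduct (crit_orbit d k)"
proof -
  have "g dvd reduct (crit_orbit d (i + k)) - reduct (crit_orbit d k)"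
    using dvd_trans[OF assms reduct_dvd[OF crit_orbit_add_cong[of d i k]]]
    by (simp add: of_int_poly_hom.hom_minus)
  thus ?thesis by (metis dvd_diff_commute dvd_diff_right_iff diff_add_cancel dvd_add_right_iff)
qed

text \<open>This is the subtractive Euclidean algorithm on indices: once \<open>g\<close> divides
  \<open>a_i\<close>, shifting an index by \<open>i\<close> does not change divisibility by
  \<open>g\<close>.\<close>

lemma dvd_reduct_crit_orbit_gcd:
  fixes g :: "'p :: prime_card mod_ring poly"
  assumes "g dvd reduct (crit_orbit d i)" "g dvd reduct (crit_orbit d j)"
  shows "g dvd reduct (crit_orbit d (gcd i j))"
  using assms
proof (induction "i + j" arbitrary: i j rule: less_induct)
  case less
  show ?case
  proof (cases "i = 0 \<or> j = 0")
    case True thus ?thesis using less.prems by auto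
  next
    case False
    consider "i \<le> j" | "j \<le> i" by linarith
    thus ?thesis
    proof cases
      case 1
      have "g dvd reduct (crit_orbit d (j - i))"
        using reduct_crit_orbit_add_dvd_iff[OF less.prems(1), of "j - i"] less.prems(2) 1 by simp
      hence "g dvd reduct (crit_orbit d (gcd i (j - i)))"
        using less.prems(1) False 1 by (intro less.hyps) auto
      moreover have "gcd i (j - i) = gcd i j" using 1 by (metis gcd.commute gcd_diff1_nat)
      ultimately show ?thesis by simp
    next
      case 2
      have "g dvd reduct (crit_orbit d (i - j))"
        using reduct_crit_orbit_add_dvd_iff[OF less.prems(2), of "i - j"] less.prems(1) 2 by simp
      hence "g dvd reduct (crit_orbit d (gcd (i - j) j))"
        using less.prems(2) False 2 by (intro less.hyps) auto
      moreover have "gcd (i - j) j = gcd i j" using 2 by (metis gcd_diff1_nat)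
      ultimately show ?thesis by simp
    qed
  qed
qed

lemma crit_orbit_square_dvd_orbit_diff:
  assumes "d \<ge> 2" "m \<ge> 1"
  shows "crit_orbit d k * crit_orbit d k dvd orbit_diff d m k"
proof (rule dvd_orbit_diff_mono)
  have "orbit_diff d 1 k = crit_orbit d k ^ d"
    using assms by (simp add: orbit_diff_def crit_orbit_Suc zero_power)
  also have "crit_orbit d k ^ 2 dvd \<dots>" using assms(1) by (rule le_imp_power_dvd)
  finally show "crit_orbit d k * crit_orbit d k dvd orbit_diff d 1 k" by (simp add: power2_eq_square)
qed (use assms in simp)

text \<open>The factor is a difference quotient at \<open>x\<close> and \<open>y\<close> with
  \<open>x\<close> congruent to \<open>y\<close> modulo \<open>a_n\<close>, so
  \<open>Y = y ^ (d - 1)\<close> works if \<open>g\<close> does not divide \<open>y\<close>. If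
  \<open>n\<close> does not divide \<open>l\<close>, then \<open>y = a_l\<close>, and
  \<open>g\<close> would divide \<open>a_(gcd l n)\<close>, whose index is a proper divisor of
  \<open>n\<close>. If \<open>n\<close> divides \<open>l\<close>, then \<open>y = a_l / a_n\<close>,
  which is 1 modulo \<open>a_n\<close>.\<close>

lemma misiurewicz_factor_mod_crit_orbit:
  fixes g :: "'p :: prime_card mod_ring poly"
  assumes d: "d = CARD('p)" and n: "n \<ge> 1" and l: "l \<ge> 1" and g: "prime_elem g"
    and dvd: "g dvd reduct (moebius_quot n (crit_orbit d))"
  obtains Y S where "misiurewicz_factor d l n n = of_nat d * Y + crit_orbit d n * S"
    and "\<not> g dvd reduct Y"
proof -
  have d2: "d \<ge> 2" using prime_card_ge_2[where ?'p = 'p] d by simp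
  have g1: "\<not> g dvd 1" using g prime_elem_not_unit by blast
  let ?a = "crit_orbit d"
  have an0: "?a n \<noteq> 0" using orbit_diff_nonzero[OF d2 n, of 0] by simp
  have gn: "g dvd reduct (?a n)"
    using dvd_trans[OF dvd reduct_dvd[OF moebius_quot_dvd[OF moebius_rigid_crit_orbit[OF d n]]]] .
  note result = that
  have main: thesis if xy: "?a n dvd x - y" "misiurewicz_factor d l n n = power_quot d x y" "\<not> g dvd reduct y" for x y
  proof -
    obtain S where "power_quot d x y - of_nat d * y ^ (d - 1) = ?a n * S"
      using dvd_trans[OF xy(1) power_quot_cong] by blast
    hence "misiurewicz_factor d l n n = of_nat d * y ^ (d - 1) + ?a n * S"
      using xy(2) by (simp add: algebra_simps)
    moreover have "\<not> g dvd reduct (y ^ (d - 1))"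
      using xy(3) g prime_elem_dvd_power by (auto simp: of_int_poly_hom.hom_power)
    ultimately show thesis by (rule result)
  qed
  show thesis
  proof (cases "n dvd l")
    case False
    have "gcd l n dvd n" by simp
    moreover have "gcd l n \<noteq> n" using False gcd_dvd1[of l n] by metis
    ultimately have "\<not> g dvd reduct (?a (gcd l n))"
      using not_dvd_reduct_crit_orbit_proper[OF d n g1 dvd] by blast
    hence "\<not> g dvd reduct (?a l)" using dvd_reduct_crit_orbit_gcd gn by blast
    moreover have "?a n dvd ?a (l + n) - ?a l"
      using crit_orbit_add_cong[of d n l] by (simp add: add.commute)
    ultimately show thesis using False by (intro main) (auto simp: misiurewicz_factor_def)
  next
    case True
    define x where "x = ?a (l + n) div ?a n"
    define y where "y = ?a l div ?a n"
    have x: "?a (l + n) = ?a n * x" and y: "?a l = ?a n * y"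
      using crit_orbit_dvd[of n] True by (simp_all add: x_def y_def)
    have "?a n * ?a n dvd ?a n * (x - y)"
      using crit_orbit_square_dvd_orbit_diff[OF d2 l, of n] x y by (simp add: orbit_diff_def algebra_simps)
    hence xy: "?a n dvd x - y" using an0 by simp
    obtain j where j: "l = Suc j * n" using True l by (metis dvdE mult.commute mult_0 not0_implies_Suc not_one_le_zero)
    have "?a n * ?a n dvd orbit_diff d n (j * n)"
      by (rule dvd_orbit_diff_mult[OF crit_orbit_square_dvd_orbit_diff[OF d2 n]])
    also have "orbit_diff d n (j * n) = ?a n * (y - 1)"
      using y j by (simp add: orbit_diff_def algebra_simps)
    finally have "?a n dvd y - 1" using an0 by simp
    from dvd_trans[OF gn reduct_dvd[OF this]] have "g dvd reduct y - 1"
      by (simp add: of_int_poly_hom.hom_minus)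
    hence "\<not> g dvd reduct y" using g1 by (metis dvd_diff_right_iff)
    with xy True show thesis by (intro main) (auto simp: misiurewicz_factor_def x_def y_def)
  qed
qed

section \<open>The Eisenstein argument at the ideal (d, g)\<close>

lemma reduct_surj: "\<exists>p. reduct p = (q :: 'p :: prime_card mod_ring poly)"
proof
  show "reduct (map_poly to_int_mod_ring q) = q"
    by (subst map_poly_map_poly) (auto simp: o_def of_int_of_int_mod_ring)
qed

lemma dvd_reduct_lift:
  fixes gl p :: "int poly"
  assumes "(reduct gl :: 'p :: prime_card mod_ring poly) dvd reduct p"
  shows "\<exists>s t. p = gl * s + of_nat CARD('p) * t"
proof -
  obtain h where h: "(reduct p :: 'p mod_ring poly) = reduct gl * h" using assms by (rule dvdE)
  obtain s where s: "h = reduct s" using reduct_surj by metis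
  have "reduct (p - gl * s) = (0 :: 'p mod_ring poly)"
    by (simp add: h s of_int_poly_hom.hom_minus of_int_poly_hom.hom_mult)
  from reduct_eq_0_imp_dvd[OF this] obtain t where "p - gl * s = of_nat CARD('p) * t" by (rule dvdE)
  hence "p = gl * s + of_nat CARD('p) * t" by (simp add: algebra_simps)
  thus ?thesis by blast
qed

text \<open>The last hypothesis says that \<open>d z\<close> lies in the square of the ideal \<open>(d, gl)\<close>.\<close>

lemma dvd_reduct_if_square_ideal:
  fixes gl z :: "int poly"
  assumes d: "d = CARD('p :: prime_card)" and nz: "(reduct gl :: 'p mod_ring poly) \<noteq> 0"
    and eq: "of_nat d * z = of_nat d * of_nat d * A + of_nat d * gl * B + gl * gl * C"
  shows "(reduct gl :: 'p mod_ring poly) dvd reduct z"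
proof -
  have d0: "(of_nat d :: int poly) \<noteq> 0" using prime_card_ge_2[where ?'p = 'p] d by simp
  \<comment> \<open>So \<open>gl * gl * C\<close> vanishes modulo \<open>d\<close> while
    \<open>gl\<close> does not, and \<open>d\<close> divides \<open>C\<close>. After cancelling one
    \<open>d\<close>, the remaining expression for \<open>z\<close> lies in
    \<open>(d, gl)\<close>.\<close>
  have "gl * gl * C = of_nat d * (z - of_nat d * A - gl * B)" using eq by (simp add: algebra_simps)
  hence "reduct (gl * gl * C) = (0 :: 'p mod_ring poly)"
    unfolding d by (simp only: of_int_poly_hom.hom_mult reduct_of_nat_card mult_zero_left)
  hence "reduct C = (0 :: 'p mod_ring poly)" using nz by (simp add: of_int_poly_hom.hom_mult)
  from reduct_eq_0_imp_dvd[OF this] obtain C' where C: "C = of_nat d * C'" unfolding d by (rule dvdE)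
  have "of_nat d * z = of_nat d * (of_nat d * A + gl * B + gl * gl * C')"
    using eq unfolding C by (simp add: algebra_simps)
  hence "z = of_nat d * A + gl * B + gl * gl * C'" using d0 by (metis mult_left_cancel)
  hence "reduct z = (reduct gl * (reduct B + reduct gl * reduct C') :: 'p mod_ring poly)"
    unfolding d by (simp only: of_int_poly_hom.hom_add of_int_poly_hom.hom_mult reduct_of_nat_card)
      (simp add: algebra_simps)
  thus ?thesis by simp
qed

lemma misiurewicz_factors_coprime_reductions:
  fixes g :: "'p :: prime_card mod_ring poly"
  assumes d: "d = CARD('p)" and n: "n \<ge> 1" and l: "l \<ge> 1" and g: "prime_elem g"
    and pq: "moebius_quot n (misiurewicz_factor d l n) = p * q"
  shows "\<not> (g dvd reduct p \<and> g dvd reduct q)"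
proof
  assume gpq: "g dvd reduct p \<and> g dvd reduct q"
  let ?T = "misiurewicz_factor d l n" let ?a = "crit_orbit d" let ?e = "reduction_exp d l n"
  let ?G = "reduct (moebius_quot n ?a) :: 'p mod_ring poly"
  have d2: "d \<ge> 2" using prime_card_ge_2[where ?'p = 'p] d by simp
  have g1: "\<not> g dvd 1" using g prime_elem_not_unit by blast
  have "g * g dvd reduct (p * q)" using gpq by (simp add: of_int_poly_hom.hom_mult mult_dvd_mono)
  hence gg: "g * g dvd ?G ^ ?e" using reduct_misiurewicz_quot[OF d n l] pq by simp
  hence gG: "g dvd ?G" using g by (metis dvd_mult_left prime_elem_dvd_power)
  have Ga: "?G dvd reduct (?a n)" by (rule reduct_dvd[OF moebius_quot_dvd[OF moebius_rigid_crit_orbit[OF d n]]])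
  \<comment> \<open>With exponent 1 the reduction of \<open>a_n\<close> would be divisible by
    \<open>g * g\<close>. Exponent at least 2 is what makes \<open>S\<close> divisible by
    \<open>g\<close> modulo \<open>d\<close>.\<close>
  have "?e \<noteq> 1"
    using gg dvd_trans[OF _ Ga, of "g * g"] square_not_dvd_reduct_crit_orbit[OF d n g1] by auto
  hence e: "?e \<ge> 2" using reduction_exp_pos[OF d2 l, of n] by (simp add: reduction_exp_def)
  obtain Y S where YS: "?T n = of_nat d * Y + ?a n * S" "\<not> g dvd reduct Y"
    using misiurewicz_factor_mod_crit_orbit[OF d n l g gG] by blast
  obtain gl where gl: "g = reduct gl" using reduct_surj by metis
  \<comment> \<open>The index \<open>n\<close> occurs in the numerator, as the Moebius value at 1 is
    1. The other numerator factors reduce to powers of \<open>a_k\<close> with \<open>k\<close> a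
    proper divisor, so \<open>g\<close> does not divide their product.\<close>
  define P where "P = (\<Prod>k \<in> {k. k dvd n \<and> moebius (n div k) = 1} - {n}. ?T k)"
  have P: "moebius_num n ?T = ?T n * P"
    unfolding moebius_num_def P_def using n by (intro prod.remove) auto
  have "\<not> g dvd reduct (?T k)" if "k dvd n" "k \<noteq> n" for k
    using not_dvd_reduct_crit_orbit_proper[OF d n g1 gG that] g prime_elem_dvd_power
    by (auto simp: reduct_misiurewicz_factor[OF d that(1) n l])
  hence gP: "\<not> g dvd reduct P"
    unfolding P_def of_int_poly_hom.hom_prod using n by (auto simp: prod_unfold_prod_mset elim!: prime_elem_dvd_prod_msetE[OF g]) blast
  have "reduct (?a n) * reduct S = reduct (?a n) * (reduct (?a n) ^ (?e - 1) :: 'p mod_ring poly)"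
  proof -
    have "reduct (of_nat d) = (0 :: 'p mod_ring poly)" unfolding d by (rule reduct_of_nat_card)
    hence "reduct (?T n) = (reduct (?a n) * reduct S :: 'p mod_ring poly)"
      unfolding YS(1) of_int_poly_hom.hom_add of_int_poly_hom.hom_mult by simp
    also have "reduct (?T n) = (reduct (?a n) ^ Suc (?e - 1) :: 'p mod_ring poly)"
      using reduct_misiurewicz_factor[OF d _ n l, of n] e by simp
    finally show ?thesis by (simp only: power_Suc)
  qed
  hence "reduct S = (reduct (?a n) ^ (?e - 1) :: 'p mod_ring poly)"
    using reduct_crit_orbit_nonzero[OF d n] by simp
  hence gS: "g dvd reduct S" using e dvd_trans[OF gG Ga] by (metis One_nat_def Suc_1 Suc_le_eq diff_Suc_1 dvd_power dvd_trans zero_less_diff)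
  \<comment> \<open>Each of \<open>p\<close>, \<open>q\<close>, \<open>a_n\<close> and
    \<open>S\<close> lies in the ideal \<open>(d, gl)\<close>. Hence \<open>p * q * D\<close> and
    \<open>a_n * S * P\<close> lie in its square, and so does their difference
    \<open>d * Y * P\<close>.\<close>
  obtain s1 t1 where 1: "p = gl * s1 + of_nat d * t1" using dvd_reduct_lift[of gl p] gpq gl d by blast
  obtain s2 t2 where 2: "q = gl * s2 + of_nat d * t2" using dvd_reduct_lift[of gl q] gpq gl d by blast
  obtain s3 t3 where 3: "?a n = gl * s3 + of_nat d * t3"
    using dvd_reduct_lift[of gl "?a n"] dvd_trans[OF gG Ga] gl d by blast
  obtain s4 t4 where 4: "S = gl * s4 + of_nat d * t4" using dvd_reduct_lift[of gl S] gS gl d by blast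
  define D where "D = moebius_den n ?T"
  have "p * q * D = (of_nat d * Y + ?a n * S) * P"
    using moebius_quot_mult_den[OF moebius_rigid_misiurewicz_factor[OF d n, of l]]
    unfolding pq P YS(1) D_def .
  hence "of_nat d * (Y * P) = p * q * D - ?a n * S * P" by (simp add: algebra_simps)
  also have "\<dots> = of_nat d * of_nat d * (t1 * t2 * D - t3 * t4 * P)
     + of_nat d * gl * ((s1 * t2 + s2 * t1) * D - (s3 * t4 + s4 * t3) * P)
     + gl * gl * (s1 * s2 * D - s3 * s4 * P)"
    unfolding 1 2 3 4 by Groebner_Basis.algebra
  finally have "reduct gl dvd (reduct (Y * P) :: 'p mod_ring poly)"
    using g gl by (intro dvd_reduct_if_square_ideal[OF d]) auto
  hence "g dvd reduct Y \<or> g dvd reduct P"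
    using g by (simp add: gl of_int_poly_hom.hom_mult prime_elem_dvd_mult_iff)
  thus False using YS(2) gP by blast
qed

section \<open>Counting irreducible factors over the rationals and modulo d\<close>

lemma clear_denominators:
  "\<exists>N a. N \<noteq> 0 \<and> Polynomial.smult (of_int N) q = map_poly rat_of_int a"
proof (induction q)
  case 0
  show ?case by (rule exI[of _ 1], rule exI[of _ 0]) simp
next
  case (pCons c q)
  then obtain N a where N: "N \<noteq> 0" "Polynomial.smult (of_int N) q = map_poly rat_of_int a" by blast
  obtain u v where uv: "c = of_int u / of_int v" "v > 0" by (metis Fract_of_int_quotient Rat_cases)
  have "Polynomial.smult (of_int (N * v)) (pCons c q) = map_poly rat_of_int (pCons (N * u) (Polynomial.smult v a))"
    using uv N(2) by (simp add: of_int_hom.map_poly_pCons_hom of_int_hom.map_poly_hom_smult mult.commute[of N]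
      flip: smult_smult)
  thus ?case using N uv(2) by (intro exI[of _ "N * v"]) auto
qed

text \<open>This is the lemma of Gauss in terms of primes. After clearing denominators
  \<open>\<pi>\<close> divides \<open>K * a * b\<close> with a nonzero constant \<open>K\<close>,
  which it cannot divide by degree.\<close>

lemma prime_elem_map_poly_rat:
  fixes \<pi> :: "int poly"
  assumes pi: "prime_elem \<pi>" and deg: "degree \<pi> > 0"
  shows "prime_elem (map_poly rat_of_int \<pi>)"
  unfolding prime_elem_def
proof (intro conjI allI impI)
  let ?M = "map_poly rat_of_int"
  show "?M \<pi> \<noteq> 0" using deg by auto
  show "\<not> ?M \<pi> dvd 1" using deg by (auto simp: poly_dvd_1)
  fix A B assume "?M \<pi> dvd A * B"
  then obtain H where H: "A * B = ?M \<pi> * H" by auto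
  obtain N a where a: "N \<noteq> 0" "Polynomial.smult (of_int N) A = ?M a" using clear_denominators by blast
  obtain N' b where b: "N' \<noteq> 0" "Polynomial.smult (of_int N') B = ?M b" using clear_denominators by blast
  obtain K h where h: "K \<noteq> 0" "Polynomial.smult (of_int K) H = ?M h" using clear_denominators by blast
  have "?M (Polynomial.smult K (a * b)) = Polynomial.smult (of_int (K * N * N')) (A * B)"
    by (simp add: of_int_poly_hom.hom_mult of_int_hom.map_poly_hom_smult ac_simps flip: a b)
  also have "\<dots> = ?M (\<pi> * Polynomial.smult (N * N') h)"
    by (simp add: H of_int_poly_hom.hom_mult of_int_hom.map_poly_hom_smult ac_simps flip: h)
  finally have "Polynomial.smult K (a * b) = \<pi> * Polynomial.smult (N * N') h" by simp
  hence "[:K:] * (a * b) = \<pi> * Polynomial.smult (N * N') h" by simp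
  hence "\<pi> dvd [:K:] * (a * b)" by (rule dvdI)
  moreover have "\<not> \<pi> dvd [:K:]" using deg h(1) dvd_imp_degree_le[of \<pi> "[:K:]"] by auto
  ultimately have "\<pi> dvd a \<or> \<pi> dvd b" using pi by (metis prime_elem_dvd_mult_iff)
  hence "?M \<pi> dvd ?M a \<or> ?M \<pi> dvd ?M b" by (auto elim!: dvdE simp: of_int_poly_hom.hom_mult)
  thus "?M \<pi> dvd A \<or> ?M \<pi> dvd B"
    using a(1) b(1) by (simp add: dvd_smult_iff flip: a(2) b(2))
qed

lemma size_prime_factorization_prod_mset:
  fixes A :: "'a :: factorial_semiring multiset"
  assumes "\<And>x. x \<in># A \<Longrightarrow> prime_elem x"
  shows "size (prime_factorization (prod_mset A)) = size A"
  using assms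
proof (induction A)
  case (add x A)
  have "0 \<notin># A" using add.prems prime_elem_not_zeroI by force
  moreover have x: "prime_elem x" using add.prems by simp
  moreover have "x \<noteq> 0" using x by auto
  ultimately show ?case using add
    using prime_factorization_prime[of "normalize x"] by (auto simp: prime_factorization_mult)
qed simp

lemma card_set_mset_le_size: "card (set_mset X) \<le> size X"
  by (induction X) (auto intro: order.trans[OF card_insert_le_m1] simp: card_insert_if)

text \<open>Every member of \<open>A\<close> divides a monic polynomial, so its reduction keeps its
  positive degree and has a prime factor. By \<open>sep\<close>, choosing one such factor for each
  member gives distinct primes.\<close>

lemma size_le_card_prime_factors_reduct:
  fixes G :: "int poly"
  assumes lc: "lead_coeff G = 1" and A: "prod_mset A = G" "\<And>x. x \<in># A \<Longrightarrow> prime_elem x"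
    and sep: "\<And>g p q. prime_elem (g :: 'p :: prime_card mod_ring poly) \<Longrightarrow> G = p * q \<Longrightarrow>
                \<not> (g dvd reduct p \<and> g dvd reduct q)"
  shows "size A \<le> card (prime_factors (reduct G :: 'p mod_ring poly))"
proof -
  let ?R = "reduct :: int poly \<Rightarrow> 'p mod_ring poly"
  have G0: "?R G \<noteq> 0"
  proof -
    have "poly.coeff (?R G) (degree G) = 1" using lc by simp
    thus ?thesis by (metis Polynomial.coeff_0 zero_neq_one)
  qed
  have "\<exists>g. g \<in> prime_factors (?R x)" if x: "x \<in># A" for x
  proof -
    have xG: "x dvd G" using A(1) x by (auto intro: dvd_prod_mset)
    have "degree x \<noteq> 0" using dvd_monic_degree_0_imp_unit[OF lc xG] A(2)[OF x] by auto
    hence "degree (?R x) \<noteq> 0" using degree_reduct_dvd_monic[OF lc xG] by metis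
    hence "?R x \<noteq> 0" "\<not> is_unit (?R x)" by (auto simp: poly_dvd_1)
    thus ?thesis by (metis prime_factorization_empty_iff multiset_nonemptyE)
  qed
  then obtain h where h: "\<And>x. x \<in># A \<Longrightarrow> h x \<in> prime_factors (?R x)" by metis
  \<comment> \<open>Taking \<open>y\<close> from \<open>A - {#x#}\<close> includes a second copy of
    \<open>x\<close>. So this gives both the injectivity of \<open>h\<close> and the absence of
    repeated members.\<close>
  have sep': "h x \<noteq> h y" if x: "x \<in># A" and y: "y \<in># A - {#x#}" for x y
  proof
    assume eq: "h x = h y"
    obtain B where B: "A = add_mset x (add_mset y B)" using x y by (metis insert_DiffM)
    have "G = x * (y * prod_mset B)" using A(1) B by simp
    moreover have "h x dvd ?R x" "h y dvd ?R y" using h x y by (auto dest: in_diffD)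
    moreover have "prime_elem (h x)" using h[OF x] by (intro prime_imp_prime_elem in_prime_factors_imp_prime)
    ultimately show False using sep[of "h x" x "y * prod_mset B"] eq
      by (simp add: of_int_poly_hom.hom_mult)
  qed
  have inj: "inj_on h (set_mset A)"
  proof (rule inj_onI, rule ccontr)
    fix x y assume "x \<in># A" "y \<in># A" "h x = h y" "x \<noteq> y"
    moreover hence "y \<in># A - {#x#}" by (simp add: in_diff_count)
    ultimately show False using sep' by blast
  qed
  have "count A x = 1" if x: "x \<in># A" for x
  proof (rule ccontr)
    assume "count A x \<noteq> 1"
    hence "x \<in># A - {#x#}" using count_greater_zero_iff[of A x, THEN iffD2, OF x]
      unfolding in_diff_count count_single by (simp del: count_greater_zero_iff)
    thus False using sep'[OF x] by blast
  qed
  hence "size A = card (set_mset A)" by (simp add: size_multiset_overloaded_eq)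
  also have "\<dots> = card (h ` set_mset A)" by (rule card_image[OF inj, symmetric])
  also have "\<dots> \<le> card (prime_factors (?R G))"
  proof (rule card_mono)
    show "h ` set_mset A \<subseteq> prime_factors (?R G)"
    proof
      fix g assume "g \<in> h ` set_mset A"
      then obtain x where x: "x \<in># A" "g = h x" by auto
      have "?R x dvd ?R G" using A(1) x by (intro reduct_dvd) (auto intro: dvd_prod_mset)
      thus "g \<in> prime_factors (?R G)" using h[OF x(1)] x(2) G0
        by (auto simp: in_prime_factors_iff intro: dvd_trans)
    qed
  qed simp
  finally show ?thesis .
qed

lemma size_prime_factorization_rat_le:
  fixes G :: "int poly"
  assumes lc: "lead_coeff G = 1"
    and sep: "\<And>g p q. prime_elem (g :: 'p :: prime_card mod_ring poly) \<Longrightarrow> G = p * q \<Longrightarrow>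
                \<not> (g dvd reduct p \<and> g dvd reduct q)"
  shows "size (prime_factorization (map_poly rat_of_int G)) \<le> card (prime_factors (reduct G :: 'p mod_ring poly))"
proof -
  have "normalize G = G" using lc by (rule normalize_monic)
  moreover have "G \<noteq> 0" using lc by auto
  moreover have "normalize (prod_mset B) = prod_mset B" if "\<And>x. x \<in># B \<Longrightarrow> prime x" for B :: "int poly multiset"
    using that by (induction B) (simp_all add: normalize_mult prime_def)
  moreover define A where "A = prime_factorization G"
  ultimately have A: "\<And>x. x \<in># A \<Longrightarrow> prime_elem x" "prod_mset A = G"
    using prod_mset_prime_factorization_weak[of G] by (metis in_prime_factors_imp_prime prime_imp_prime_elem)+
  have "prime_elem (map_poly rat_of_int x)" if x: "x \<in># A" for x
  proof (rule prime_elem_map_poly_rat)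
    have "x dvd G" using A(2) x by (auto intro: dvd_prod_mset)
    thus "degree x > 0" using dvd_monic_degree_0_imp_unit[OF lc] A(1)[OF x] by (metis gr0I prime_elem_not_unit)
  qed (use A x in auto)
  moreover have "map_poly rat_of_int G = prod_mset (image_mset (map_poly rat_of_int) A)"
    unfolding A(2)[symmetric] by (induction A) (auto simp: of_int_poly_hom.hom_mult)
  ultimately have "size (prime_factorization (map_poly rat_of_int G)) = size A"
    using size_prime_factorization_prod_mset[of "image_mset (map_poly rat_of_int) A"] by auto
  thus ?thesis using size_le_card_prime_factors_reduct[OF lc A(2,1) sep] by simp
qed

section \<open>Monicity and the final comparison\<close>

lemma lead_coeff_moebius_quot_misiurewicz_factor:
  assumes d: "d = CARD('p :: prime_card)" and n: "n \<ge> 1"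
  shows "lead_coeff (moebius_quot n (misiurewicz_factor d l n)) = 1"
proof -
  let ?T = "misiurewicz_factor d l n"
  have d2: "d \<ge> 2" using prime_card_ge_2[where ?'p = 'p] d by simp
  have T: "lead_coeff (?T k) = 1" if "k dvd n" for k
  proof -
    have "k \<ge> 1" using that n by (cases "k = 0") auto
    note lc = lead_coeff_orbit_diff[OF d2 this]
    show ?thesis
      using arg_cong[OF misiurewicz_factor_mult[OF d2 that, of l], of lead_coeff] lc[of l] lc[of 0] lc[of "Suc l"]
      by (simp add: lead_coeff_mult lead_coeff_power)
  qed
  have "lead_coeff (moebius_num n ?T) = 1" "lead_coeff (moebius_den n ?T) = 1"
    unfolding moebius_num_def moebius_den_def lead_coeff_prod using T by (auto intro!: prod.neutral)
  thus ?thesis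
    using arg_cong[OF moebius_quot_mult_den[OF moebius_rigid_misiurewicz_factor[OF d n, of l]], of lead_coeff]
    by (simp add: lead_coeff_mult)
qed

lemma irreducible_if_size_prime_factorization_le_1:
  fixes x :: "'a :: factorial_semiring"
  assumes "size (prime_factorization x) \<le> 1" "x \<noteq> 0" "\<not> is_unit x"
  shows "irreducible x"
proof -
  have "prime_factorization x \<noteq> {#}" using assms by (simp add: prime_factorization_empty_iff)
  hence "size (prime_factorization x) = 1" using assms(1) by (simp add: le_Suc_eq)
  then obtain q where q: "prime_factorization x = {#q#}" by (metis size_1_singleton_mset)
  have "prime q" using q by (metis in_prime_factors_imp_prime multi_member_last)
  moreover have "normalize x = normalize q"
    using prod_mset_prime_factorization_weak[OF assms(2)] q by simp
  ultimately have "prime_elem x" by (metis prime_elem_normalize_iff prime_imp_prime_elem)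
  thus ?thesis by (simp add: prime_elem_iff_irreducible)
qed

theorem theorem1p4:
  fixes d m n :: nat
  assumes "prime d" and "CARD('p :: prime_card) = d" and "m \<ge> 2" and "n \<ge> 1"
  shows "num_irreducible_factors (map_poly of_int (misiurewicz_poly d m n) :: rat poly)
           \<le> num_irreducible_factors (map_poly of_int (misiurewicz_poly d 0 n) :: 'p mod_ring poly)
       \<and> (irreducible (map_poly of_int (misiurewicz_poly d 0 n) :: 'p mod_ring poly)
           \<longrightarrow> irreducible (map_poly of_int (misiurewicz_poly d m n) :: rat poly))"
proof -
  have d: "d = CARD('p)" using assms(2) by simp
  have d2: "d \<ge> 2" using prime_card_ge_2[where ?'p = 'p] d by simp
  obtain l where m: "m = Suc l" and l: "l \<ge> 1" using assms(3) by (cases m) auto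
  define G where "G = misiurewicz_poly d m n"
  define H where "H = (reduct (misiurewicz_poly d 0 n) :: 'p mod_ring poly)"
  let ?e = "reduction_exp d l n"
  have G: "G = moebius_quot n (misiurewicz_factor d l n)"
    unfolding G_def m by (rule misiurewicz_poly_Suc[OF d assms(4) l])
  have redG: "reduct G = H ^ ?e"
    unfolding G H_def misiurewicz_poly_0[OF d assms(4)] by (rule reduct_misiurewicz_quot[OF d assms(4) l])
  have e: "?e > 0" using reduction_exp_pos[OF d2 l, of n] by (simp add: reduction_exp_def)
  have lc: "lead_coeff G = 1" unfolding G by (rule lead_coeff_moebius_quot_misiurewicz_factor[OF d assms(4)])
  hence G0: "map_poly rat_of_int G \<noteq> 0" by auto
  have "poly.coeff (reduct G :: 'p mod_ring poly) (degree G) = 1" using lc by simp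
  hence "reduct G \<noteq> (0 :: 'p mod_ring poly)" by (metis Polynomial.coeff_0 zero_neq_one)
  hence H0: "H \<noteq> 0" using redG e by (auto simp: zero_power)
  have "size (prime_factorization (map_poly rat_of_int G)) \<le> card (prime_factors (reduct G :: 'p mod_ring poly))"
    by (rule size_prime_factorization_rat_le[OF lc])
      (rule misiurewicz_factors_coprime_reductions[OF d assms(4) l], assumption, simp only: G[symmetric])
  \<comment> \<open>A prime dividing the power \<open>H ^ ?e\<close> divides \<open>H\<close>, so
    the exponent does not affect the number of distinct primes.\<close>
  also have "\<dots> \<le> card (prime_factors H)"
    using H0 by (intro card_mono) (auto simp: redG in_prime_factors_iff dest: prime_dvd_power)
  also have "\<dots> \<le> size (prime_factorization H)" by (rule card_set_mset_le_size)
  finally have le: "size (prime_factorization (map_poly rat_of_int G)) \<le> size (prime_factorization H)" .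
  have "irreducible (map_poly rat_of_int G)" if irr: "irreducible H"
  proof (rule irreducible_if_size_prime_factorization_le_1)
    have "prime_elem H" using irr by (simp add: prime_elem_iff_irreducible)
    thus "size (prime_factorization (map_poly rat_of_int G)) \<le> 1"
      using le size_prime_factorization_prod_mset[of "{#H#}"] by simp
    \<comment> \<open>The bound of one factor still allows a unit. It is excluded because the
      reduction of \<open>G\<close> is a positive power of a non-unit, so \<open>G\<close> is not
      constant.\<close>
    have "\<not> is_unit (H ^ ?e)" using irreducible_not_unit[OF irr] e by (simp only: is_unit_power_iff) simp
    hence "\<not> is_unit G" unfolding redG[symmetric]
      by (metis of_int_poly_hom.hom_dvd of_int_poly_hom.hom_one)
    hence "degree G \<noteq> 0" using dvd_monic_degree_0_imp_unit[OF lc, of G] by auto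
    thus "\<not> is_unit (map_poly rat_of_int G)" by (auto simp: poly_dvd_1)
  qed (use G0 in simp)
  thus ?thesis
    using le G0 H0 unfolding G_def H_def
    by (simp add: num_irreducible_factors_eq_size_prime_factorization)
qed

end
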